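(* Up to duality and twin maps, the edge-biregular maps $M=(H;x,y,s,t)$ with no semi-edges carried by a surface of Euler characteristic $\chi=-2$ are exactly the following (twelve) non-isomorphic maps: 1. One self-dual map of type $(8,8)$ with a single vertex and a single face, with group $$H_{2,1}=\langle x,y,s,t\mid x^2,y^2,s^2,t^2,(xy)^2,(st)^2,(ty)^4,(sx)^4,ysxs,txsx,xtyt,syty\rangle\cong D_8.$$ 2. One map of type $(4,12)$ with three vertices and a single face, with group $$H_{2,2}=\langle x,y,s,t\mid x^2,y^2,s^2,t^2,(xy)^2,(st)^2,(ty)^2,(sx)^6,xyt,t(sx)^3\rangle\cong D_{12}.$$ 3. One self-dual map of type $(6,6)$ with two vertices and two faces, with group $$H_{2,3}=\langle x,y,s,t\mid x^2,y^2,s^2,t^2,(xy)^2,(st)^2,(ty)^3,(sx)^3,styx\rangle\cong D_{12}.$$ 4. Six maps of type $(4,8)$ with four vertices and two faces, with groups $H_{2,i}\cong D_8\times C_2$ for $i=4,5,6,7,8,9$ presented as \begin{align*} H_{2,4}&=\langle x,y,s,t\mid x^2,y^2,s^2,t^2,(xy)^2,(st)^2,(ty)^2,(sx)^4,(ys)^4,(tx)^2,ysxs\rangle\\ H_{2,5}&=\langle x,y,s,t\mid x^2,y^2,s^2,t^2,(xy)^2,(st)^2,(ty)^2,(sx)^4,(ys)^2,(tx)^2,y(sx)^2\rangle\\ H_{2,6}&=\langle x,y,s,t\mid x^2,y^2,s^2,t^2,(xy)^2,(st)^2,(ty)^2,(sx)^4,(ys)^2,(stx)^2,y(sx)^2\rangle\\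 H_{2,7}&=\langle x,y,s,t\mid x^2,y^2,s^2,t^2,(xy)^2,(st)^2,(ty)^2,(sx)^4,(ys)^2,(tx)^2,ty(sx)^2\rangle\\ H_{2,8}&=\langle x,y,s,t\mid x^2,y^2,s^2,t^2,(xy)^2,(st)^2,(ty)^2,(sx)^4,(ys)^2,(stx)^2,tyxsx\rangle\\ H_{2,9}&=\langle x,y,s,t\mid x^2,y^2,s^2,t^2,(xy)^2,(st)^2,(ty)^2,(sx)^4,(ys)^2,(stx)^2,tys\rangle \end{align*} 5. Three maps of type $(4,6)$ with six vertices and four faces, with groups $H_{2,i}$ for $i=10,11,12$ given by \begin{align*} H_{2,10}&=\langle x,y,s,t\mid x^2,y^2,s^2,t^2,(xy)^2,(st)^2,(ty)^2,(sx)^3,t(sy)^2,y(xt)^2\rangle\cong S_4\\ H_{2,11}&=\langle x,y,s,t\mid x^2,y^2,s^2,t^2,(xy)^2,(st)^2,(ty)^2,(sx)^3,(ysx)^2,(tx)^2\rangle\cong D_6\times V_4\\ H_{2,12}&=\langle x,y,s,t\mid x^2,y^2,s^2,t^2,(xy)^2,(st)^2,(ty)^2,(sx)^3,(ys)^2,(tx)^2\rangle\cong D_6\times V_4 \end{align*} The maps with groups $H_{2,1}$, $H_{2,3}$, $H_{2,4}$, $H_{2,7}$, $H_{2,11}$ and $H_{2,12}$ are orientable while the other six are not, and the only fully regular ones out of the twelve are those with groups $H_{2,1}$, $H_{2,3}$, $H_{2,7}$, $H_{2,10}$ and $H_{2,12}$.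
   Context: Conventions: $D_n$ denotes the dihedral group of order $n$ ($n$ even), $C_n$ is the cyclic group of order $n$, $V_4\cong C_2\times C_2$, and $S_4$ is the symmetric group of degree 4. In a presentation, listing a word as a relator means that it equals $1$. A (finite) edge-biregular map of type $(k,\ell)$ ($k,\ell$ even) with no semi-edges, on a surface without boundary, is given in canonical form $M=(H;x,y,s,t)$ by a finite group $H$ with an ordered quadruple of pairwise distinct involutions $x,y,s,t$ generating $H$ such that $(xy)^2=(st)^2=1$, $ty$ has order exactly $k/2$ and $sx$ has order exactly $\ell/2$. (Geometrically, $H$ is a group of automorphisms of the map with two orbits on edges; $\langle t,y\rangle\cong D_k$ and $\langle s,x\rangle\cong D_\ell$ are stabilisers of a vertex and a face, and $\langle x,y\rangle$, $\langle s,t\rangle$ are stabilisers of edges in the two orbits.) The map has $|H|/k$ vertices, $|H|/\ell$ faces and $|H|/2$ edges, so its carrier surface has Euler characteristic $\chi=|H|\left(\frac1k-\frac12+\frac1\ell\right)$. The map is orientable (its carrier surface is orientable) if and only if no word of odd length in $x,y,s,t$ equals $1$ in $H$. Two maps $(H;x,y,s,t)$ and $(H';x',y',s',t')$ are isomorphic if there is a group isomorphism $H\to H'$ taking $x,y,s,t$ to $x',y',s',t'$ respectively. The twin of $(H;x,y,s,t)$ is $(H;s,t,x,y)$; the dual is $(H;y,x,t,s)$. The map is fully regular if it is isomorphic to its twin, and self-dual if it is isomorphic to its dual. "Up to duality and twin maps" means that every map of the kind considered is isomorphic to one obtained from a listed map by applying the dual and twin operations (possibly none, one or both). *)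

theory Defs
  imports Complex_Main "HOL-Algebra.Algebra"
begin

section \<open>Edge-biregular maps in canonical form\<close>

text \<open>A group together with an ordered quadruple of its elements, written \<open>(H; x, y, s, t)\<close>.\<close>

record 'a ebmap = "'a monoid" +
  eb_x :: 'a
  eb_y :: 'a
  eb_s :: 'a
  eb_t :: 'a

definition eb_gens :: "'a ebmap \<Rightarrow> 'a list" where
  "eb_gens M = [eb_x M, eb_y M, eb_s M, eb_t M]"

locale edge_biregular_map = group M for M :: "'a ebmap" (structure) +
  fixes k l :: nat
  assumes fin: "finite (carrier M)"
    and gens_closed: "set (eb_gens M) \<subseteq> carrier M"
    and gens_distinct: "distinct (eb_gens M)"
    and gens_involution: "g \<in> set (eb_gens M) \<Longrightarrow> ord g = 2"
    and gens_generate: "generate M (set (eb_gens M)) = carrier M"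
    and xy_relation: "(eb_x M \<otimes> eb_y M) [^] (2::nat) = \<one>"
    and st_relation: "(eb_s M \<otimes> eb_t M) [^] (2::nat) = \<one>"
    and even_k: "even k"
    and even_l: "even l"
    and ord_ty: "ord (eb_t M \<otimes> eb_y M) = k div 2"
    and ord_sx: "ord (eb_s M \<otimes> eb_x M) = l div 2"

text \<open>
  Vertices, faces and edges correspond to the cosets of their stabilisers: the vertex stabiliser
  generated by \<open>t\<close> and \<open>y\<close> has order \<open>k\<close>, the face stabiliser generated by \<open>s\<close> and \<open>x\<close> has
  order \<open>l\<close>, and there are two edge orbits with stabilisers (generated by \<open>x, y\<close> and by
  \<open>s, t\<close>) of order 4.
\<close>

definition num_vertices :: "'a ebmap \<Rightarrow> nat \<Rightarrow> real" where
  "num_vertices M k = real (order M) / real k"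

definition num_faces :: "'a ebmap \<Rightarrow> nat \<Rightarrow> real" where
  "num_faces M l = real (order M) / real l"

definition num_edges :: "'a ebmap \<Rightarrow> real" where
  "num_edges M = real (order M) / 2"

definition euler_char :: "'a ebmap \<Rightarrow> nat \<Rightarrow> nat \<Rightarrow> real" where
  "euler_char M k l = num_vertices M k - num_edges M + num_faces M l"

definition orientable :: "'a ebmap \<Rightarrow> bool" where
  "orientable M \<longleftrightarrow>
     (\<forall>w \<in> lists (set (eb_gens M)). odd (length w) \<longrightarrow> foldr (\<otimes>\<^bsub>M\<^esub>) w \<one>\<^bsub>M\<^esub> \<noteq> \<one>\<^bsub>M\<^esub>)"

definition map_iso :: "'a ebmap \<Rightarrow> 'b ebmap \<Rightarrow> bool" where
  "map_iso M N \<longleftrightarrow>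
     (\<exists>h \<in> iso M N. h (eb_x M) = eb_x N \<and> h (eb_y M) = eb_y N \<and>
                    h (eb_s M) = eb_s N \<and> h (eb_t M) = eb_t N)"

definition twin :: "'a ebmap \<Rightarrow> 'a ebmap" where
  "twin M = M\<lparr>eb_x := eb_s M, eb_y := eb_t M, eb_s := eb_x M, eb_t := eb_y M\<rparr>"

definition dual :: "'a ebmap \<Rightarrow> 'a ebmap" where
  "dual M = M\<lparr>eb_x := eb_y M, eb_y := eb_x M, eb_s := eb_t M, eb_t := eb_s M\<rparr>"

definition fully_regular :: "'a ebmap \<Rightarrow> bool" where
  "fully_regular M \<longleftrightarrow> map_iso M (twin M)"

definition self_dual :: "'a ebmap \<Rightarrow> bool" where
  "self_dual M \<longleftrightarrow> map_iso M (dual M)"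

text \<open>The two operations are commuting involutions, so these are all their compositions.\<close>

definition dual_twin_orbit :: "'a ebmap \<Rightarrow> 'a ebmap set" where
  "dual_twin_orbit M = {M, twin M, dual M, dual (twin M)}"

definition iso_up_to_dual_twin :: "'a ebmap \<Rightarrow> 'b ebmap \<Rightarrow> bool" where
  "iso_up_to_dual_twin M N \<longleftrightarrow> (\<exists>N' \<in> dual_twin_orbit N. map_iso M N')"


section \<open>Groups given by presentations\<close>

text \<open>
  A word is a list of letters \<open>(g, b)\<close>, standing for the generator \<open>g\<close> if \<open>b\<close> is \<open>False\<close> and for
  its formal inverse if \<open>b\<close> is \<open>True\<close>. The group presented by the relators \<open>R\<close> on all elements of
  the type \<open>'g\<close> as generators is the monoid of words modulo the congruence generated by the
  cancellation of mutually inverse letters and the deletion of relators.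
\<close>

type_synonym 'g word = "('g \<times> bool) list"

inductive pres_eq :: "'g word set \<Rightarrow> 'g word \<Rightarrow> 'g word \<Rightarrow> bool" for R where
  refl: "pres_eq R u u"
| sym: "pres_eq R u v \<Longrightarrow> pres_eq R v u"
| trans: "pres_eq R u v \<Longrightarrow> pres_eq R v w \<Longrightarrow> pres_eq R u w"
| cancel: "pres_eq R (u @ [(g, b), (g, \<not> b)] @ v) (u @ v)"
| relator: "r \<in> R \<Longrightarrow> pres_eq R (u @ r @ v) (u @ v)"

definition pres_class :: "'g word set \<Rightarrow> 'g word \<Rightarrow> 'g word set" where
  "pres_class R u = {v. pres_eq R u v}"

definition presented_group :: "'g word set \<Rightarrow> 'g word set monoid" where
  "presented_group R =
     \<lparr> carrier = range (pres_class R),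
       monoid.mult = (\<lambda>A B. \<Union>u\<in>A. \<Union>v\<in>B. pres_class R (u @ v)),
       one = pres_class R [] \<rparr>"

datatype gen = Gx | Gy | Gs | Gt

definition positive_word :: "gen list \<Rightarrow> gen word" where
  "positive_word = map (\<lambda>g. (g, False))"

definition presented_map :: "gen list list \<Rightarrow> gen word set ebmap" where
  "presented_map rels =
     (let R = set (map positive_word rels);
          G = presented_group R;
          gen_class = (\<lambda>g. pres_class R (positive_word [g]))
      in \<lparr> carrier = carrier G, monoid.mult = monoid.mult G, one = one G,
           eb_x = gen_class Gx, eb_y = gen_class Gy, eb_s = gen_class Gs, eb_t = gen_class Gt \<rparr>)"


section \<open>The twelve maps\<close>

abbreviation word_power :: "'b list \<Rightarrow> nat \<Rightarrow> 'b list" (infixr \<open>\<up>\<close> 90) where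
  "w \<up> n \<equiv> concat (replicate n w)"

definition base_relators :: "nat \<Rightarrow> nat \<Rightarrow> gen list list" where
  "base_relators m n =
     [[Gx]\<up>2, [Gy]\<up>2, [Gs]\<up>2, [Gt]\<up>2, [Gx,Gy]\<up>2, [Gs,Gt]\<up>2, [Gt,Gy]\<up>m, [Gs,Gx]\<up>n]"

definition H2_relators :: "gen list list list" where
  "H2_relators =
    [base_relators 4 4 @ [[Gy,Gs,Gx,Gs], [Gt,Gx,Gs,Gx], [Gx,Gt,Gy,Gt], [Gs,Gy,Gt,Gy]],
     base_relators 2 6 @ [[Gx,Gy,Gt], [Gt] @ [Gs,Gx]\<up>3],
     base_relators 3 3 @ [[Gs,Gt,Gy,Gx]],
     base_relators 2 4 @ [[Gy,Gs]\<up>4, [Gt,Gx]\<up>2, [Gy,Gs,Gx,Gs]],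
     base_relators 2 4 @ [[Gy,Gs]\<up>2, [Gt,Gx]\<up>2, [Gy] @ [Gs,Gx]\<up>2],
     base_relators 2 4 @ [[Gy,Gs]\<up>2, [Gs,Gt,Gx]\<up>2, [Gy] @ [Gs,Gx]\<up>2],
     base_relators 2 4 @ [[Gy,Gs]\<up>2, [Gt,Gx]\<up>2, [Gt,Gy] @ [Gs,Gx]\<up>2],
     base_relators 2 4 @ [[Gy,Gs]\<up>2, [Gs,Gt,Gx]\<up>2, [Gt,Gy,Gx,Gs,Gx]],
     base_relators 2 4 @ [[Gy,Gs]\<up>2, [Gs,Gt,Gx]\<up>2, [Gt,Gy,Gs]],
     base_relators 2 3 @ [[Gt] @ [Gs,Gy]\<up>2, [Gy] @ [Gx,Gt]\<up>2],
     base_relators 2 3 @ [[Gy,Gs,Gx]\<up>2, [Gt,Gx]\<up>2],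
     base_relators 2 3 @ [[Gy,Gs]\<up>2, [Gt,Gx]\<up>2]]"

text \<open>The index \<open>i\<close> ranges from 1 to 12.\<close>

definition H2 :: "nat \<Rightarrow> gen word set ebmap" where
  "H2 i = presented_map (H2_relators ! (i - 1))"


section \<open>The isomorphism types\<close>

text \<open>
  The dihedral group of order \<open>n\<close> (\<open>n\<close> even): the pair \<open>(a, p)\<close> stands for \<open>r\<^sup>a\<close> if \<open>p\<close> is \<open>False\<close>
  and for \<open>r\<^sup>a f\<close> if \<open>p\<close> is \<open>True\<close>, where the rotation \<open>r\<close> has order \<open>n div 2\<close> and the reflection
  \<open>f\<close> inverts \<open>r\<close>.
\<close>

definition dihedral_group :: "nat \<Rightarrow> (int \<times> bool) monoid" where
  "dihedral_group n =
     \<lparr> carrier = {0..<int (n div 2)} \<times> UNIV,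
       monoid.mult = (\<lambda>(a, p) (b, q). ((a + (if p then - b else b)) mod int (n div 2), p \<noteq> q)),
       one = (0, False) \<rparr>"

abbreviation cyclic2 :: "int monoid" where
  "cyclic2 \<equiv> integer_mod_group 2"

abbreviation klein_four :: "(int \<times> int) monoid" where
  "klein_four \<equiv> cyclic2 \<times>\<times> cyclic2"

end

theory Submission
  imports Defs
begin

text \<open>
  Let \<open>(H; x, y, s, t)\<close> be an edge-biregular map of type \<open>(2a, 2b)\<close> and Euler characteristic \<open>-2\<close>, so that
  \<open>|H| (ab - a - b) = 4ab\<close>. The stabiliser \<open>N\<close> of a face, generated by \<open>s\<close> and \<open>x\<close>, is dihedral of order \<open>2b\<close>,
  hence \<open>2b\<close> divides \<open>|H|\<close>. Duality allows \<open>a \<le> b\<close>, and then \<open>(a, b, |H|)\<close> is one of \<open>(4, 4, 8)\<close>,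
  \<open>(2, 6, 12)\<close>, \<open>(3, 3, 12)\<close>, \<open>(2, 4, 16)\<close>, \<open>(2, 3, 24)\<close> (\<open>euler_type_arith\<close>).

  In these cases \<open>N\<close> has index \<open>1\<close>, \<open>2\<close> or \<open>4\<close>, the number of faces, and \<open>t\<close> and \<open>y\<close> provide representatives of
  its cosets, possibly after passing to the twin map. So the elements of \<open>H\<close> have coordinates: a rotation
  or reflection in \<open>N\<close>, followed by at most one \<open>t\<close> and at most one \<open>y\<close>. Since \<open>xy = yx\<close> and \<open>st = ts\<close>, the
  multiplication of \<open>H\<close> is determined by the coordinates of two elements: of \<open>y\<close> and \<open>t\<close> if there is one face,
  of \<open>y\<close> and \<open>txt\<close> if there are two, of \<open>tx\<close> and \<open>ys\<close> if there are four. There are finitely many choices. Each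
  choice either contradicts a relation that holds in every map, or makes the relators of a listed map or
  of its twin trivial (\<open>classified_one_face\<close>, \<open>classified_two_faces\<close>, \<open>classified_four_faces\<close>). A group that
  satisfies the relators is a quotient of the presented group, and the orders agree, so the map is
  isomorphic to the listed one (\<open>map_iso_presented_map\<close>).

  For the presented groups themselves everything rests on the solution of the word problem by Cayley
  tables (\<open>word_problem\<close>), whose correctness is certified by a coset enumeration. Orders of elements, the
  failure of relators and thereby the absence of isomorphisms, self-duality and full regularity are
  then read off from closed walks in a table. Orientability is the parity of the relators. The
  isomorphism with a concrete group is given by images of the generators, and its injectivity is a
  finite check on representatives of the elements.
\<close>

section \<open>Words in a group with four marked involutions\<close>

text \<open>
  The group axioms depend only on carrier, product and unit, not on the marking that a map adds to
  its group.
\<close>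

lemma group_same_structure:
  assumes "group G" "carrier H = carrier G" "monoid.mult H = monoid.mult G" "one H = one G"
  shows "group H"
proof -
  interpret group G by fact
  show ?thesis
    by (rule groupI) (use assms(2-4) in \<open>auto simp: m_assoc intro: l_inv_ex\<close>)
qed

fun letter :: "'a ebmap \<Rightarrow> gen \<Rightarrow> 'a" where
  "letter M Gx = eb_x M"
| "letter M Gy = eb_y M"
| "letter M Gs = eb_s M"
| "letter M Gt = eb_t M"

definition word_val :: "'a ebmap \<Rightarrow> gen list \<Rightarrow> 'a" where
  "word_val M w = foldr (\<lambda>g. (\<otimes>\<^bsub>M\<^esub>) (letter M g)) w \<one>\<^bsub>M\<^esub>"

definition satisfies :: "'a ebmap \<Rightarrow> gen list list \<Rightarrow> bool" where
  "satisfies M rels \<longleftrightarrow> (\<forall>r\<in>set rels. word_val M r = \<one>\<^bsub>M\<^esub>)"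

lemma UNIV_gen: "(UNIV :: gen set) = {Gx, Gy, Gs, Gt}"
  using gen.exhaust by auto

lemma all_gen_iff: "(\<forall>g. P g) \<longleftrightarrow> P Gx \<and> P Gy \<and> P Gs \<and> P Gt"
  by (metis gen.exhaust)

lemma set_eb_gens: "set (eb_gens M) = range (letter M)"
  by (auto simp: eb_gens_def UNIV_gen)

lemma word_val_Nil [simp]: "word_val M [] = \<one>\<^bsub>M\<^esub>"
  and word_val_Cons: "word_val M (g # w) = letter M g \<otimes>\<^bsub>M\<^esub> word_val M w"
  by (simp_all add: word_val_def)

locale marked_involutions = group M for M :: "'a ebmap" (structure) +
  assumes letter_closed [simp, intro]: "letter M g \<in> carrier M"
    and letter_square: "letter M g \<otimes> letter M g = \<one>"
begin

lemma word_closed [simp, intro]: "word_val M w \<in> carrier M"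
  by (induction w) (simp_all add: word_val_Cons)

lemma word_val_append: "word_val M (u @ v) = word_val M u \<otimes> word_val M v"
  by (induction u) (simp_all add: word_val_Cons m_assoc)

lemma word_val_single: "word_val M [g] = letter M g"
  by (simp add: word_val_Cons)

lemma word_val_power: "word_val M (w \<up> n) = word_val M w [^] n"
proof (induction n)
  case (Suc n)
  then show ?case
    using nat_pow_Suc2[OF word_closed[of w], of n] by (simp add: word_val_append)
qed simp

lemma word_val_rev: "word_val M (rev w) = inv (word_val M w)"
proof (induction w)
  case (Cons g w)
  have "inv (letter M g) = letter M g"
    by (simp add: inv_equality letter_square)
  with Cons show ?case
    by (simp add: word_val_append word_val_Cons inv_mult_group)
qed simp

end

text \<open>
  Generation is expressed by positive words alone: involutions are their own inverses, so the values of
  positive words form a subgroup.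
\<close>

locale marked_group = marked_involutions M for M :: "'a ebmap" (structure) +
  assumes carrier_eq_words: "carrier M = range (word_val M)"

lemma marked_groupI:
  fixes M :: "'a ebmap" (structure)
  assumes "group M" and cl: "\<And>g. letter M g \<in> carrier M"
    and sq: "\<And>g. letter M g \<otimes> letter M g = \<one>"
    and gen: "generate M (range (letter M)) = carrier M"
  shows "marked_group M"
proof -
  interpret marked_involutions M
    using assms by (intro marked_involutions.intro marked_involutions_axioms.intro)
  have inv_letter: "inv (letter M g) = letter M g" for g
    by (simp add: inv_equality sq)
  have "z \<in> generate M (range (letter M)) \<Longrightarrow> z \<in> range (word_val M)" for z
  proof (induction rule: generate.induct)
    case one
    show ?case by (rule range_eqI[of _ _ "[]"]) simp
  next
    case (incl h)
    then obtain g where "h = letter M g" by auto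
    then show ?case by (intro range_eqI[of _ _ "[g]"]) (simp add: word_val_single)
  next
    case (inv h)
    then obtain g where "h = letter M g" by auto
    then show ?case
      by (intro range_eqI[of _ _ "[g]"]) (simp add: word_val_single inv_letter)
  next
    case (eng h1 h2)
    then obtain u v where "h1 = word_val M u" "h2 = word_val M v" by blast
    then show ?case by (simp flip: word_val_append)
  qed
  then have "carrier M = range (word_val M)"
    using gen by blast
  then show ?thesis
    by unfold_locales
qed

lemma (in marked_group) generate_letters: "generate M (range (letter M)) = carrier M"
proof
  show "generate M (range (letter M)) \<subseteq> carrier M"
    by (rule generate_incl) auto
  have "word_val M w \<in> generate M (range (letter M))" for w
    by (induction w) (auto simp: word_val_Cons intro: generate.intros)
  then show "carrier M \<subseteq> generate M (range (letter M))"
    by (auto simp: carrier_eq_words)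
qed

lemma edge_biregular_map_marked:
  fixes M :: "'a ebmap" (structure)
  assumes "edge_biregular_map M k l"
  shows "marked_group M"
proof -
  interpret edge_biregular_map M k l by fact
  have letter_in: "letter M g \<in> set (eb_gens M)" for g
    by (simp add: set_eb_gens)
  have cl: "letter M g \<in> carrier M" for g
    using gens_closed letter_in by blast
  have "letter M g \<otimes> letter M g = \<one>" for g
    using pow_ord_eq_1[OF cl[of g]] gens_involution[OF letter_in[of g]] cl[of g]
    by (simp add: numeral_2_eq_2)
  with cl gens_generate show ?thesis
    by (intro marked_groupI) (auto simp: set_eb_gens is_group)
qed


subsection \<open>Relabelling: duality and twins\<close>

text \<open>
  Twin and dual permute the names of the four generators. The permutations involved form a Klein
  four-group, which lets all statements about them be proved at once.
\<close>

definition relabel :: "(gen \<Rightarrow> gen) \<Rightarrow> 'a ebmap \<Rightarrow> 'a ebmap" where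
  "relabel \<sigma> M = M\<lparr>eb_x := letter M (\<sigma> Gx), eb_y := letter M (\<sigma> Gy),
                    eb_s := letter M (\<sigma> Gs), eb_t := letter M (\<sigma> Gt)\<rparr>"

fun twin_gen :: "gen \<Rightarrow> gen" where
  "twin_gen Gx = Gs" | "twin_gen Gy = Gt" | "twin_gen Gs = Gx" | "twin_gen Gt = Gy"

fun dual_gen :: "gen \<Rightarrow> gen" where
  "dual_gen Gx = Gy" | "dual_gen Gy = Gx" | "dual_gen Gs = Gt" | "dual_gen Gt = Gs"

definition relabellings :: "(gen \<Rightarrow> gen) list" where
  "relabellings = [id, twin_gen, dual_gen, twin_gen \<circ> dual_gen]"

lemma relabel_id [simp]: "relabel id M = M"
  by (simp add: relabel_def)

lemma twin_eq_relabel: "twin M = relabel twin_gen M"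
  and dual_eq_relabel: "dual M = relabel dual_gen M"
  by (simp_all add: twin_def dual_def relabel_def)

lemma letter_relabel [simp]: "letter (relabel \<sigma> M) g = letter M (\<sigma> g)"
  by (cases g) (simp_all add: relabel_def)

lemma relabel_simps [simp]:
  "carrier (relabel \<sigma> M) = carrier M" "monoid.mult (relabel \<sigma> M) = monoid.mult M"
  "one (relabel \<sigma> M) = one M"
  by (simp_all add: relabel_def)

lemma relabel_relabel: "relabel \<tau> (relabel \<sigma> M) = relabel (\<sigma> \<circ> \<tau>) M"
  unfolding relabel_def[of \<tau>] relabel_def[of "\<sigma> \<circ> \<tau>"] letter_relabel
  by (simp add: relabel_def)

lemma word_val_relabel: "word_val (relabel \<sigma> M) w = word_val M (map \<sigma> w)"
  by (simp add: word_val_def foldr_map comp_def)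

lemma relabelling_involution: "\<sigma> \<in> set relabellings \<Longrightarrow> \<sigma> \<circ> \<sigma> = id"
proof (rule ext)
  fix g assume "\<sigma> \<in> set relabellings"
  then show "(\<sigma> \<circ> \<sigma>) g = id g"
    unfolding relabellings_def by (cases g) auto
qed

lemma dual_twin_orbit_eq: "dual_twin_orbit M = (\<lambda>\<sigma>. relabel \<sigma> M) ` set relabellings"
  by (simp add: dual_twin_orbit_def relabellings_def twin_eq_relabel dual_eq_relabel relabel_relabel)

lemma group_relabel: "group M \<Longrightarrow> group (relabel \<sigma> M)"
  by (rule group_same_structure) simp_all

lemma order_relabel [simp]: "order (relabel \<sigma> M) = order M"
  by (simp add: order_def)

lemma marked_group_relabel:
  assumes "marked_group M" "\<sigma> \<in> set relabellings"
  shows "marked_group (relabel \<sigma> M)"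
proof -
  interpret marked_group M by fact
  have "word_val M w = word_val (relabel \<sigma> M) (map \<sigma> w)" for w
    using relabelling_involution[OF assms(2)] by (simp add: word_val_relabel)
  then have "range (word_val M) \<subseteq> range (word_val (relabel \<sigma> M))"
    by (metis image_subsetI rangeI)
  then have "range (word_val (relabel \<sigma> M)) = carrier M"
    by (auto simp: word_val_relabel carrier_eq_words)
  then show ?thesis
    using group_relabel[OF is_group] by (simp add: marked_group_def marked_group_axioms_def
        marked_involutions_def marked_involutions_axioms_def letter_square)
qed


subsection \<open>Isomorphisms\<close>

lemma map_iso_iff: "map_iso M N \<longleftrightarrow> (\<exists>h\<in>iso M N. \<forall>g. h (letter M g) = letter N g)"
  by (simp add: map_iso_def all_gen_iff)

lemma map_iso_relabel: "map_iso M N \<Longrightarrow> map_iso (relabel \<sigma> M) (relabel \<sigma> N)"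
  by (auto simp: map_iso_iff iso_def hom_def Pi_def)

lemma map_iso_sym:
  assumes "group M" "group N" "\<And>g. letter M g \<in> carrier M" "map_iso M N"
  shows "map_iso N M"
proof -
  obtain h where h: "h \<in> iso M N" "\<And>g. h (letter M g) = letter N g"
    using assms(4) by (auto simp: map_iso_iff)
  have "inv_into (carrier M) h \<in> iso N M"
    using h(1) group.iso_set_sym[OF assms(1)] by blast
  moreover have "inv_into (carrier M) h (letter N g) = letter M g" for g
    using h(1) assms(3)[of g] by (simp add: iso_def bij_betw_def inv_into_f_f flip: h(2))
  ultimately show ?thesis by (auto simp: map_iso_iff)
qed

lemma hom_word_val:
  assumes "marked_involutions M" "group N" "h \<in> hom M N" "\<And>g. h (letter M g) = letter N g"
  shows "h (word_val M w) = word_val N w"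
proof -
  interpret marked_involutions M by fact
  have "h \<one>\<^bsub>M\<^esub> = \<one>\<^bsub>N\<^esub>"
    using assms(2,3) hom_one is_group by blast
  with assms show ?thesis
    by (induction w) (auto simp: word_val_Cons hom_mult)
qed

text \<open>
  Isomorphic maps satisfy the same relations between their generators; this is the only obstruction
  that is needed to tell maps apart.
\<close>

lemma map_iso_word_val:
  assumes M: "marked_group M" and N: "marked_group N" and iso: "map_iso M N"
  shows "word_val M w = \<one>\<^bsub>M\<^esub> \<longleftrightarrow> word_val N w = \<one>\<^bsub>N\<^esub>"
proof -
  interpret M: marked_group M by fact
  interpret N: marked_group N by fact
  have one: "word_val N' w = \<one>\<^bsub>N'\<^esub>"
    if "marked_group M'" "marked_group N'" and iso: "map_iso M' N'"
      and triv: "word_val M' w = \<one>\<^bsub>M'\<^esub>"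
    for M' :: "'x ebmap" and N' :: "'y ebmap"
  proof -
    interpret M': marked_group M' by fact
    interpret N': marked_group N' by fact
    obtain h where "h \<in> hom M' N'" "\<And>g. h (letter M' g) = letter N' g"
      using iso by (auto simp: map_iso_iff iso_def)
    then show ?thesis
      using hom_word_val[OF M'.marked_involutions_axioms N'.is_group, of h w] triv
        hom_one[of h M' N'] M'.is_group N'.is_group by simp
  qed
  show ?thesis
    using one[OF M N iso] one[OF N M map_iso_sym[OF M.is_group N.is_group M.letter_closed iso]]
    by blast
qed

section \<open>Presented groups\<close>

definition inverse_word :: "'g word \<Rightarrow> 'g word" where
  "inverse_word u = rev (map (\<lambda>(g, b). (g, \<not> b)) u)"

lemma pres_eq_context: "pres_eq R u v \<Longrightarrow> pres_eq R (a @ u @ c) (a @ v @ c)"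
proof (induction rule: pres_eq.induct)
  case (cancel u g b v)
  then show ?case using pres_eq.cancel[of R "a @ u" g b "v @ c"] by simp
next
  case (relator r u v)
  then show ?case using pres_eq.relator[of r R "a @ u" "v @ c"] by simp
qed (auto intro: pres_eq.intros)

lemma pres_eq_append: "pres_eq R u u' \<Longrightarrow> pres_eq R v v' \<Longrightarrow> pres_eq R (u @ v) (u' @ v')"
  using pres_eq_context[of R u u' "[]" v] pres_eq_context[of R v v' u' "[]"] pres_eq.trans by force

lemma pres_class_eq_iff: "pres_class R u = pres_class R v \<longleftrightarrow> pres_eq R u v"
proof
  assume "pres_class R u = pres_class R v"
  moreover have "v \<in> pres_class R v" by (simp add: pres_class_def pres_eq.refl)
  ultimately have "v \<in> pres_class R u" by simp
  then show "pres_eq R u v" by (simp add: pres_class_def)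
next
  assume "pres_eq R u v"
  then show "pres_class R u = pres_class R v"
    unfolding pres_class_def by (intro Collect_cong iffI) (rule pres_eq.trans, erule pres_eq.sym, assumption, erule (1) pres_eq.trans)
qed

lemma pres_eq_inverse: "pres_eq R (inverse_word u @ u) []"
proof (induction u)
  case Nil
  then show ?case by (simp add: inverse_word_def pres_eq.refl)
next
  case (Cons p u)
  obtain g b where p: "p = (g, b)" by (cases p)
  have "pres_eq R (inverse_word u @ [(g, \<not> b), (g, \<not> \<not> b)] @ u) (inverse_word u @ u)"
    by (rule pres_eq.cancel)
  with Cons show ?case
    by (auto simp: inverse_word_def p intro: pres_eq.trans)
qed

lemma presented_group_mult:
  "pres_class R u \<otimes>\<^bsub>presented_group R\<^esub> pres_class R v = pres_class R (u @ v)"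
proof -
  have "pres_class R (u' @ v') = pres_class R (u @ v)"
    if "u' \<in> pres_class R u" "v' \<in> pres_class R v" for u' v'
    using that by (auto simp: pres_class_eq_iff pres_class_def[of R u] pres_class_def[of R v]
      intro: pres_eq_append pres_eq.sym)
  moreover have "u \<in> pres_class R u" "v \<in> pres_class R v"
    by (auto simp: pres_class_def pres_eq.refl)
  ultimately have "(\<Union>u'\<in>pres_class R u. \<Union>v'\<in>pres_class R v. pres_class R (u' @ v')) = pres_class R (u @ v)"
    by blast
  then show ?thesis by (simp add: presented_group_def)
qed

lemma presented_group_simps:
  "carrier (presented_group R) = range (pres_class R)"
  "\<one>\<^bsub>presented_group R\<^esub> = pres_class R []"
  by (simp_all add: presented_group_def)

lemma group_presented_group: "group (presented_group R)"
proof (rule groupI)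
  fix A assume "A \<in> carrier (presented_group R)"
  then obtain u where "A = pres_class R u" by (auto simp: presented_group_simps)
  then show "\<exists>B\<in>carrier (presented_group R). B \<otimes>\<^bsub>presented_group R\<^esub> A = \<one>\<^bsub>presented_group R\<^esub>"
    by (auto simp: presented_group_simps presented_group_mult pres_class_eq_iff
      intro!: bexI[of _ "pres_class R (inverse_word u)"] pres_eq_inverse)
qed (auto simp: presented_group_simps presented_group_mult)

abbreviation relator_words :: "gen list list \<Rightarrow> gen word set" where
  "relator_words rels \<equiv> positive_word ` set rels"

lemma positive_word_simps [simp]:
  "positive_word [] = []" "positive_word (g # w) = (g, False) # positive_word w"
  "map fst (positive_word w) = w"
  by (simp_all add: positive_word_def comp_def)

lemma presented_map_simps:
  "carrier (presented_map rels) = carrier (presented_group (relator_words rels))"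
  "monoid.mult (presented_map rels) = monoid.mult (presented_group (relator_words rels))"
  "one (presented_map rels) = one (presented_group (relator_words rels))"
  "letter (presented_map rels) g = pres_class (relator_words rels) (positive_word [g])"
  by (cases g; simp add: presented_map_def Let_def)+

lemma group_presented_map: "group (presented_map rels)"
  by (rule group_same_structure[OF group_presented_group[of "relator_words rels"]])
    (simp_all only: presented_map_simps)

lemma word_val_presented_map:
  "word_val (presented_map rels) w = pres_class (relator_words rels) (positive_word w)"
  by (induction w) (simp_all add: word_val_Cons presented_map_simps presented_group_simps
      presented_group_mult)

lemma satisfies_presented_map: "satisfies (presented_map rels) rels"
  using pres_eq.relator[of _ "relator_words rels" "[]" "[]"]
  by (auto simp: satisfies_def word_val_presented_map presented_map_simps presented_group_simps
      pres_class_eq_iff)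

definition squares :: "gen list list" where
  "squares = [[Gx, Gx], [Gy, Gy], [Gs, Gs], [Gt, Gt]]"

lemma set_squares: "set squares = (\<lambda>g. [g, g]) ` UNIV"
  by (simp add: squares_def UNIV_gen)

text \<open>
  If the squares of the generators are relators, a formal inverse is congruent to the generator
  itself, so that every class contains a positive word.
\<close>

lemma marked_group_presented_map:
  assumes "set squares \<subseteq> set rels"
  shows "marked_group (presented_map rels)"
proof -
  let ?P = "presented_map rels"
  interpret group ?P by (rule group_presented_map)
  have cl: "letter ?P g \<in> carrier ?P" for g
    by (simp add: presented_map_simps presented_group_simps)
  have sq: "letter ?P g \<otimes>\<^bsub>?P\<^esub> letter ?P g = \<one>\<^bsub>?P\<^esub>" for g
    using satisfies_presented_map[of rels] assms cl[of g]
    by (auto simp: set_squares satisfies_def word_val_Cons dest!: subsetD[of _ _ "[g, g]"])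
  have inv: "inv\<^bsub>?P\<^esub> (letter ?P g) = letter ?P g" for g
    by (simp add: inv_equality sq cl)
  \<comment> \<open>The letter with inverse flag is a left inverse of the plain letter, and so is the plain letter itself.\<close>
  have pos: "pres_class (relator_words rels) [(g, b)] = letter ?P g" for g b
  proof (cases b)
    case True
    have "pres_class (relator_words rels) [(g, True)] \<otimes>\<^bsub>?P\<^esub> letter ?P g = \<one>\<^bsub>?P\<^esub>"
      using pres_eq.cancel[of "relator_words rels" "[]" g True "[]"]
      by (simp add: presented_map_simps presented_group_mult presented_group_simps
          pres_class_eq_iff)
    then have "pres_class (relator_words rels) [(g, True)] = inv\<^bsub>?P\<^esub> (letter ?P g)"
      using cl inv_equality by (metis presented_map_simps(1) presented_group_simps(1) rangeI)
    with inv True show ?thesis by simp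
  qed (simp add: presented_map_simps)
  have "pres_class (relator_words rels) u = word_val ?P (map fst u)" for u
  proof (induction u)
    case (Cons p u)
    have "pres_class (relator_words rels) (p # u)
        = pres_class (relator_words rels) [p] \<otimes>\<^bsub>?P\<^esub> pres_class (relator_words rels) u"
      by (simp add: presented_map_simps presented_group_mult)
    with Cons show ?case
      using pos[of "fst p" "snd p"] by (simp add: word_val_Cons)
  qed (simp add: presented_map_simps presented_group_simps)
  then have "carrier ?P = range (word_val ?P)"
    by (auto simp: presented_map_simps(1) presented_group_simps word_val_presented_map)
  with cl sq show ?thesis by unfold_locales auto
qed

text \<open>
  Von Dyck's theorem. Evaluating a word in a group that satisfies the relators is constant on
  congruence classes; the inverse flags may be ignored because the marked elements are involutions.
\<close>

lemma von_dyck: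
  assumes "marked_involutions M" "satisfies M rels"
  obtains h where "h \<in> hom (presented_map rels) M"
    "\<And>g. h (letter (presented_map rels) g) = letter M g"
proof -
  let ?P = "presented_map rels" and ?R = "relator_words rels"
  interpret marked_involutions M by fact
  have eq: "pres_eq ?R u v \<Longrightarrow> word_val M (map fst u) = word_val M (map fst v)" for u v
  proof (induction rule: pres_eq.induct)
    case (cancel u g b v)
    then show ?case
      by (simp add: word_val_append word_val_Cons letter_square flip: m_assoc)
  next
    case (relator r u v)
    then have "word_val M (map fst r) = \<one>\<^bsub>M\<^esub>"
      using assms(2) by (auto simp: satisfies_def)
    then show ?case by (simp add: word_val_append)
  qed auto
  define h where "h = (\<lambda>A :: gen word set. word_val M (map fst (SOME u. u \<in> A)))"
  have h: "h (pres_class ?R u) = word_val M (map fst u)" for u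
  proof -
    have "(SOME v. v \<in> pres_class ?R u) \<in> pres_class ?R u"
      by (rule someI[of _ u]) (simp add: pres_class_def pres_eq.refl)
    then show ?thesis
      unfolding h_def using eq by (auto simp: pres_class_def)
  qed
  show thesis
  proof
    show "h \<in> hom ?P M"
      by (auto simp: hom_def presented_map_simps presented_group_simps presented_group_mult h
          word_val_append)
    show "h (letter ?P g) = letter M g" for g
      by (simp add: presented_map_simps h word_val_single)
  qed
qed

text \<open>
  The criterion behind all isomorphisms between maps: a group that satisfies the relators is a quotient
  of the presented group, and a quotient of the same finite order is the group itself.
\<close>

lemma map_iso_presented_map:
  assumes M: "marked_group M" and sat: "satisfies M rels"
    and sq: "set squares \<subseteq> set rels"
    and fin: "finite (carrier (presented_map rels))"
    and ord: "order (presented_map rels) \<le> order M"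
  shows "map_iso (presented_map rels) M"
proof -
  let ?P = "presented_map rels"
  interpret M: marked_group M by fact
  interpret P: marked_group ?P by (rule marked_group_presented_map) fact
  obtain h where h: "h \<in> hom ?P M" "\<And>g. h (letter ?P g) = letter M g"
    using von_dyck[OF M.marked_involutions_axioms sat] by blast
  have surj: "h ` carrier ?P = carrier M"
    using hom_word_val[OF P.marked_involutions_axioms M.is_group h]
    by (auto simp: M.carrier_eq_words P.carrier_eq_words image_iff)
  then have "card (carrier M) \<le> card (carrier ?P)"
    using card_image_le[OF fin, of h] by simp
  with ord surj fin have "inj_on h (carrier ?P)"
    by (intro eq_card_imp_inj_on) (auto simp: order_def)
  with h surj show ?thesis
    by (auto simp: map_iso_iff iso_def bij_betw_def)
qed

section \<open>Cayley tables\<close>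

text \<open>
  A table consists of four rows of numbers, one for each of \<open>x\<close>, \<open>y\<close>, \<open>s\<close>, \<open>t\<close>; entry \<open>j\<close> of a row is
  the element that right multiplication by this generator makes of the element number \<open>j\<close>, and \<open>0\<close> is
  the unit. Two independent reasons make a table the true Cayley table of a presented group.

  If every relator, started anywhere, leads back to where it started, then the presented group acts
  on the numbers, so words that lead from \<open>0\<close> to different numbers are different elements.

  Conversely, name the number \<open>j\<close> by a word that leads from \<open>0\<close> to \<open>j\<close>. An entry is called an edge
  if it is a true equation between these names in the presented group. Entries along a spanning tree
  are edges by the choice of the names. If all entries but one along a closed relator path are edges,
  the missing one is an edge too, because the relator is trivial: this is the deduction step of
  Todd--Coxeter coset enumeration. Once all entries have been deduced, every word equals the name of
  the number it leads to.
\<close>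

fun gen_index :: "gen \<Rightarrow> nat" where
  "gen_index Gx = 0" | "gen_index Gy = 1" | "gen_index Gs = 2" | "gen_index Gt = 3"

definition step :: "nat list list \<Rightarrow> gen \<Rightarrow> nat \<Rightarrow> nat" where
  "step T g j = T ! gen_index g ! j"

definition walk :: "nat list list \<Rightarrow> gen list \<Rightarrow> nat \<Rightarrow> nat" where
  "walk T = fold (step T)"

text \<open>
  A generator that leads to a smaller number. In a table numbered breadth-first such a generator exists
  for every number but \<open>0\<close>, and the chosen ones form a spanning tree.
\<close>

definition descend :: "nat list list \<Rightarrow> nat \<Rightarrow> gen option" where
  "descend T j = find (\<lambda>g. step T g j < j) [Gx, Gy, Gs, Gt]"

function tree_word :: "nat list list \<Rightarrow> nat \<Rightarrow> gen list" where
  "tree_word T j = (case descend T j of None \<Rightarrow> [] | Some g \<Rightarrow> tree_word T (step T g j) @ [g])"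
  by auto

lemma descend_less: "descend T j = Some g \<Longrightarrow> step T g j < j"
  by (auto simp: descend_def split: if_splits)

termination
  by (relation "measure snd") (auto dest: descend_less)

declare tree_word.simps [simp del]

definition known :: "bool list list \<Rightarrow> gen \<Rightarrow> nat \<Rightarrow> bool" where
  "known K g j = K ! gen_index g ! j"

definition mark :: "gen \<Rightarrow> nat \<Rightarrow> bool list list \<Rightarrow> bool list list" where
  "mark g j K = K[gen_index g := (K ! gen_index g)[j := True]]"

fun gaps :: "nat list list \<Rightarrow> bool list list \<Rightarrow> gen list \<Rightarrow> nat \<Rightarrow> (gen \<times> nat) list" where
  "gaps T K [] j = []"
| "gaps T K (g # w) j =
     (if known K g j then gaps T K w (step T g j) else (g, j) # gaps T K w (step T g j))"

text \<open>
  The generators are involutions, so each edge comes with its reverse.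
\<close>

definition add_edge :: "nat list list \<Rightarrow> gen \<Rightarrow> nat \<Rightarrow> bool list list \<Rightarrow> bool list list" where
  "add_edge T g j K = mark g j (mark g (step T g j) K)"

definition tree_edges :: "nat list list \<Rightarrow> nat \<Rightarrow> bool list list" where
  "tree_edges T n =
     fold (\<lambda>j K. case descend T j of None \<Rightarrow> K | Some g \<Rightarrow> add_edge T g j K) [0..<n]
       (replicate 4 (replicate n False))"

definition deduce :: "nat list list \<Rightarrow> nat \<Rightarrow> gen list \<Rightarrow> bool list list \<Rightarrow> bool list list" where
  "deduce T j r K = (case gaps T K r j of [(g, i)] \<Rightarrow> add_edge T g i K | _ \<Rightarrow> K)"

text \<open>
  A single pass, trying every relator at every number once, is enough for all tables below.
\<close>

definition deduced_edges :: "gen list list \<Rightarrow> nat list list \<Rightarrow> nat \<Rightarrow> bool list list" where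
  "deduced_edges rels T n = fold (\<lambda>j. fold (deduce T j) rels) [0..<n] (tree_edges T n)"

definition cayley_table :: "gen list list \<Rightarrow> nat \<Rightarrow> nat list list \<Rightarrow> bool" where
  "cayley_table rels n T \<longleftrightarrow>
     0 < n \<and>
     list_all (\<lambda>g. list_all (\<lambda>j. step T g j < n) [0..<n]) [Gx, Gy, Gs, Gt] \<and>
     list_all (\<lambda>r. list_all (\<lambda>j. walk T r j = j) [0..<n]) rels \<and>
     list_all (\<lambda>r. r \<in> set rels) squares \<and>
     list_all (\<lambda>j. descend T j \<noteq> None) [1..<n] \<and>
     (let K = deduced_edges rels T n
      in list_all (\<lambda>g. list_all (known K g) [0..<n]) [Gx, Gy, Gs, Gt])"

lemma gen_index_eq_iff: "gen_index g = gen_index h \<longleftrightarrow> g = h"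
  by (cases g; cases h) simp_all

lemma gen_index_less: "gen_index g < 4"
  by (cases g) simp_all

lemma nth_list_update_cases: "xs[i := x] ! j = xs ! j \<or> xs[i := x] ! j = x \<and> i = j"
  by (cases "i < length xs") (auto simp: nth_list_update list_update_beyond)

lemma known_mark:
  assumes "known (mark g i K) h j"
  shows "known K h j \<or> h = g \<and> j = i"
  using assms nth_list_update_cases[of K "gen_index g" "(K ! gen_index g)[i := True]" "gen_index h"]
    nth_list_update_cases[of "K ! gen_index g" i True j]
  by (auto simp: known_def mark_def gen_index_eq_iff)

lemma walk_Nil [simp]: "walk T [] j = j"
  and walk_Cons [simp]: "walk T (g # w) j = walk T w (step T g j)"
  and walk_append: "walk T (u @ v) j = walk T v (walk T u j)"
  by (simp_all add: walk_def)

lemma tree_word_0: "tree_word T 0 = []"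
  using descend_less[of T 0] by (cases "descend T 0") (auto simp: tree_word.simps)

locale certified_cayley_table =
  fixes rels :: "gen list list" and n :: nat and T :: "nat list list"
  assumes certificate: "cayley_table rels n T"
begin

abbreviation P :: "gen word set ebmap" where "P \<equiv> presented_map rels"

lemma n_pos: "0 < n"
  and step_less: "j < n \<Longrightarrow> step T g j < n"
  and walk_relator: "r \<in> set rels \<Longrightarrow> j < n \<Longrightarrow> walk T r j = j"
  and squares_subset: "set squares \<subseteq> set rels"
  and descend_ex: "0 < j \<Longrightarrow> j < n \<Longrightarrow> \<exists>g. descend T j = Some g"
  and all_deduced: "j < n \<Longrightarrow> known (deduced_edges rels T n) g j"
  using certificate unfolding cayley_table_def
  by (simp_all add: list_all_iff Let_def subset_iff) (cases g; auto)+

sublocale P: marked_group P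
  by (rule marked_group_presented_map) (rule squares_subset)

lemma step_step: "j < n \<Longrightarrow> step T g (step T g j) = j"
  using walk_relator[of "[g, g]" j] squares_subset by (auto simp: set_squares)

lemma walk_less: "j < n \<Longrightarrow> walk T w j < n"
  by (induction w arbitrary: j) (auto simp: step_less)

definition val :: "nat \<Rightarrow> gen word set" where
  "val j = word_val P (tree_word T j)"

definition edge :: "gen \<Rightarrow> nat \<Rightarrow> bool" where
  "edge g j \<longleftrightarrow> val j \<otimes>\<^bsub>P\<^esub> letter P g = val (step T g j)"

definition sound :: "bool list list \<Rightarrow> bool" where
  "sound K \<longleftrightarrow> (\<forall>g. \<forall>j<n. known K g j \<longrightarrow> edge g j)"

lemma val_closed [simp]: "val j \<in> carrier P"
  by (simp add: val_def)

lemma val_0 [simp]: "val 0 = \<one>\<^bsub>P\<^esub>"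
  by (simp add: val_def tree_word_0)

lemma edge_reverse: "j < n \<Longrightarrow> edge g j \<Longrightarrow> edge g (step T g j)"
proof -
  assume "j < n" and e: "edge g j"
  then have "val (step T g j) \<otimes>\<^bsub>P\<^esub> letter P g = (val j \<otimes>\<^bsub>P\<^esub> letter P g) \<otimes>\<^bsub>P\<^esub> letter P g"
    by (simp add: edge_def)
  also have "\<dots> = val j"
    by (simp add: P.m_assoc P.letter_square)
  finally show ?thesis
    using \<open>j < n\<close> by (simp add: edge_def step_step)
qed

lemma add_edge_sound: "\<lbrakk>sound K; edge g j; j < n\<rbrakk> \<Longrightarrow> sound (add_edge T g j K)"
  using edge_reverse[of j g] unfolding add_edge_def sound_def by (blast dest: known_mark)

lemma tree_edge:
  assumes "descend T j = Some g" "j < n"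
  shows "edge g j"
proof -
  have "val j = val (step T g j) \<otimes>\<^bsub>P\<^esub> letter P g"
    using assms by (simp add: val_def tree_word.simps[of T j] P.word_val_append P.word_val_single)
  then show ?thesis
    using assms by (simp add: edge_def P.m_assoc P.letter_square)
qed

lemma tree_edges_sound: "sound (tree_edges T n)"
  unfolding tree_edges_def
proof (rule fold_invariant[where Q = "\<lambda>j. j < n"])
  fix j K assume "j < n" "sound K"
  then show "sound (case descend T j of None \<Rightarrow> K | Some g \<Rightarrow> add_edge T g j K)"
    by (cases "descend T j") (simp_all add: add_edge_sound tree_edge)
next
  show "sound (replicate 4 (replicate n False))"
    by (auto simp: sound_def known_def gen_index_less)
qed simp

lemma no_gaps_path:
  assumes "sound K" "gaps T K w j = []" "j < n"
  shows "val j \<otimes>\<^bsub>P\<^esub> word_val P w = val (walk T w j)"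
  using assms(2-)
proof (induction w arbitrary: j)
  case (Cons g w)
  then have "edge g j" using assms(1) by (auto simp: sound_def split: if_splits)
  then have "val j \<otimes>\<^bsub>P\<^esub> letter P g = val (step T g j)" by (simp add: edge_def)
  with Cons show ?case
    by (auto simp: word_val_Cons step_less simp flip: P.m_assoc split: if_splits)
qed simp

text \<open>
  The deduction step: the known edges before the gap carry the start of the path to the gap, those
  behind it carry the end of the path back, and cancelling them isolates the unknown entry.
\<close>

lemma single_gap_edge:
  assumes "sound K" "gaps T K w j = [(g, i)]" "j < n"
    and "val j \<otimes>\<^bsub>P\<^esub> word_val P w = val (walk T w j)"
  shows "edge g i \<and> i < n"
  using assms(2-)
proof (induction w arbitrary: j)
  case (Cons h w)
  show ?case
  proof (cases "known K h j")
    case True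
    then have "val j \<otimes>\<^bsub>P\<^esub> letter P h = val (step T h j)"
      using assms(1) Cons.prems by (auto simp: sound_def edge_def)
    then have "val (step T h j) \<otimes>\<^bsub>P\<^esub> word_val P w = val j \<otimes>\<^bsub>P\<^esub> word_val P (h # w)"
      by (simp add: word_val_Cons flip: P.m_assoc)
    with Cons.prems True show ?thesis
      by (intro Cons.IH) (simp_all add: step_less)
  next
    case False
    with Cons.prems have [simp]: "h = g" "j = i" and rest: "gaps T K w (step T g i) = []"
      by auto
    have "(val i \<otimes>\<^bsub>P\<^esub> letter P g) \<otimes>\<^bsub>P\<^esub> word_val P w = val (step T g i) \<otimes>\<^bsub>P\<^esub> word_val P w"
      using Cons.prems no_gaps_path[OF assms(1) rest] by (simp add: step_less word_val_Cons P.m_assoc)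
    then show ?thesis
      using Cons.prems by (simp add: edge_def)
  qed
qed simp

lemma deduce_sound:
  assumes K: "sound K" and "j < n" "r \<in> set rels"
  shows "sound (deduce T j r K)"
proof (cases "\<exists>g i. gaps T K r j = [(g, i)]")
  case True
  then obtain g i where gap: "gaps T K r j = [(g, i)]" by blast
  have "val j \<otimes>\<^bsub>P\<^esub> word_val P r = val (walk T r j)"
    using assms satisfies_presented_map[of rels] by (simp add: walk_relator satisfies_def)
  then show ?thesis
    using single_gap_edge[OF K gap \<open>j < n\<close>] K \<open>j < n\<close> by (simp add: deduce_def gap add_edge_sound)
next
  case False
  then have "deduce T j r K = K"
    by (cases "gaps T K r j" rule: remdups_adj.cases) (auto simp: deduce_def)
  with K show ?thesis by simp
qed

lemma deduced_edges_sound: "sound (deduced_edges rels T n)"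
  unfolding deduced_edges_def
proof (rule fold_invariant[where Q = "\<lambda>j. j < n"])
  fix j K assume j: "j < n" and "sound K"
  show "sound (fold (deduce T j) rels K)"
    using \<open>sound K\<close> by (rule fold_invariant[where Q = "\<lambda>r. r \<in> set rels", rotated]) (simp_all add: deduce_sound j)
qed (simp_all add: tree_edges_sound)

lemma val_walk: "j < n \<Longrightarrow> val j \<otimes>\<^bsub>P\<^esub> word_val P w = val (walk T w j)"
proof (induction w arbitrary: j)
  case (Cons g w)
  then have "val j \<otimes>\<^bsub>P\<^esub> letter P g = val (step T g j)"
    using all_deduced[of j g] deduced_edges_sound by (auto simp: sound_def edge_def)
  with Cons show ?case
    by (simp add: word_val_Cons step_less P.m_assoc[symmetric])
qed simp

text \<open>
  The presented group acts on the numbers; both kinds of elementary moves act trivially.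
\<close>

lemma walk_pres_eq:
  "pres_eq (relator_words rels) u v \<Longrightarrow> j < n \<Longrightarrow> walk T (map fst u) j = walk T (map fst v) j"
proof (induction arbitrary: j rule: pres_eq.induct)
  case (cancel u g b v)
  then show ?case by (simp add: walk_append step_step walk_less)
next
  case (relator r u v)
  then show ?case by (auto simp: walk_append walk_relator walk_less)
qed auto

lemma walk_tree_word: "j < n \<Longrightarrow> walk T (tree_word T j) 0 = j"
proof (induction j rule: less_induct)
  case (less j)
  show ?case
  proof (cases "j = 0")
    case False
    then obtain g where g: "descend T j = Some g"
      using descend_ex less.prems by blast
    then show ?thesis
      using less descend_less[OF g]
      by (simp add: tree_word.simps[of T j] walk_append step_step)
  qed (simp add: tree_word_0)
qed

text \<open>
  The two halves of the argument together: equal elements act equally, and a word equals the name of the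
  number to which it leads.
\<close>

theorem word_problem: "word_val P u = word_val P v \<longleftrightarrow> walk T u 0 = walk T v 0"
proof
  assume "word_val P u = word_val P v"
  then show "walk T u 0 = walk T v 0"
    using walk_pres_eq[of "positive_word u" "positive_word v" 0] n_pos
    by (simp add: word_val_presented_map pres_class_eq_iff)
next
  assume "walk T u 0 = walk T v 0"
  then show "word_val P u = word_val P v"
    using val_walk[OF n_pos, of u] val_walk[OF n_pos, of v] by simp
qed

corollary word_trivial: "word_val P u = \<one>\<^bsub>P\<^esub> \<longleftrightarrow> walk T u 0 = 0"
  using word_problem[of u "[]"] by simp

lemma carrier_eq_val: "carrier P = val ` {..<n}"
proof -
  have "word_val P w = val (walk T w 0)" for w
    using val_walk[OF n_pos, of w] by simp
  then show ?thesis
    using walk_less[OF n_pos] by (auto simp: P.carrier_eq_words val_def image_iff)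
qed

lemma val_inj: "inj_on val {..<n}"
  by (rule inj_onI) (metis lessThan_iff val_def walk_tree_word word_problem)

lemma order_P: "order P = n" and finite_P: "finite (carrier P)"
  by (simp_all add: order_def carrier_eq_val card_image[OF val_inj])

end

section \<open>Deciding properties of a presented map\<close>

context certified_cayley_table
begin

text \<open>
  A relabelled copy of the presented group has the same order, so it is isomorphic to the original as
  soon as it satisfies the relators. This decides full regularity and self-duality.
\<close>

lemma map_iso_relabel_iff:
  assumes "\<sigma> \<in> set relabellings"
  shows "map_iso P (relabel \<sigma> P) \<longleftrightarrow> list_all (\<lambda>r. walk T (map \<sigma> r) 0 = 0) rels"
proof -
  have Q: "marked_group (relabel \<sigma> P)"
    using assms by (intro marked_group_relabel P.marked_group_axioms)
  have "satisfies (relabel \<sigma> P) rels \<longleftrightarrow> list_all (\<lambda>r. walk T (map \<sigma> r) 0 = 0) rels"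
    by (simp add: satisfies_def list_all_iff word_val_relabel word_trivial)
  moreover have "map_iso P (relabel \<sigma> P)" if "satisfies (relabel \<sigma> P) rels"
    using map_iso_presented_map[OF Q that squares_subset finite_P] by simp
  moreover have "satisfies (relabel \<sigma> P) rels" if iso: "map_iso P (relabel \<sigma> P)"
    using map_iso_word_val[OF P.marked_group_axioms Q iso] satisfies_presented_map[of rels]
    by (auto simp: satisfies_def)
  ultimately show ?thesis by blast
qed

text \<open>
  An isomorphism onto a relabelled copy of \<open>M\<close> would force the relabelled relators of \<open>M\<close> to be trivial,
  and one walk that does not close refutes this.
\<close>

lemma not_iso_up_to_dual_twin:
  assumes M: "marked_group M"
    and distinguish: "list_all (\<lambda>\<sigma>. list_ex (\<lambda>r. walk T (map \<sigma> r) 0 \<noteq> 0) rels') relabellings"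
    and sat: "satisfies M rels'"
  shows "\<not> iso_up_to_dual_twin P M"
proof
  assume "iso_up_to_dual_twin P M"
  then obtain \<sigma> where \<sigma>: "\<sigma> \<in> set relabellings" and iso: "map_iso P (relabel \<sigma> M)"
    by (auto simp: iso_up_to_dual_twin_def dual_twin_orbit_eq)
  obtain r where r: "r \<in> set rels'" "walk T (map \<sigma> r) 0 \<noteq> 0"
    using distinguish \<sigma> by (auto simp: list_all_iff list_ex_iff)
  have "word_val (relabel \<sigma> M) (map \<sigma> r) = word_val M r"
    using relabelling_involution[OF \<sigma>] by (simp add: word_val_relabel)
  then have "word_val P (map \<sigma> r) = \<one>\<^bsub>P\<^esub>"
    using map_iso_word_val[OF P.marked_group_axioms marked_group_relabel[OF M \<sigma>] iso] sat r(1)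
    by (simp add: satisfies_def)
  with r(2) show False
    by (simp add: word_trivial)
qed

lemma ord_word:
  assumes "0 < m" "word_val P w [^]\<^bsub>P\<^esub> m = \<one>\<^bsub>P\<^esub>" "list_all (\<lambda>i. walk T (w \<up> i) 0 \<noteq> 0) [1..<m]"
  shows "P.ord (word_val P w) = m"
proof -
  have dvd: "P.ord (word_val P w) dvd m"
    using assms(2) P.pow_eq_id by blast
  then have pos: "0 < P.ord (word_val P w)" using assms(1) by (auto intro: Nat.gr0I)
  have "word_val P (w \<up> P.ord (word_val P w)) = \<one>\<^bsub>P\<^esub>"
    by (simp add: P.word_val_power)
  then have "walk T (w \<up> P.ord (word_val P w)) 0 = 0"
    by (simp only: word_trivial)
  with assms(3) have "\<not> P.ord (word_val P w) < m"
    using pos by (auto simp: list_all_iff Suc_le_eq dest!: bspec[of _ _ "P.ord (word_val P w)"])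
  with dvd show ?thesis
    using dvd_imp_le[OF dvd assms(1)] by simp
qed

lemma presented_edge_biregular_map:
  assumes base: "list_all (\<lambda>r. r \<in> set rels) (base_relators a b)" and ab: "0 < a" "0 < b"
    and dist: "distinct (map (\<lambda>w. walk T w 0) [[], [Gx], [Gy], [Gs], [Gt]])"
    and ty: "list_all (\<lambda>m. walk T ([Gt, Gy] \<up> m) 0 \<noteq> 0) [1..<a]"
    and sx: "list_all (\<lambda>m. walk T ([Gs, Gx] \<up> m) 0 \<noteq> 0) [1..<b]"
  shows "edge_biregular_map P (2 * a) (2 * b)"
proof -
  have rel: "word_val P r = \<one>\<^bsub>P\<^esub>" if "r \<in> set (base_relators a b)" for r
    using that base satisfies_presented_map[of rels] by (auto simp: satisfies_def list_all_iff)
  have pow: "word_val P w [^]\<^bsub>P\<^esub> m = \<one>\<^bsub>P\<^esub>" if "w \<up> m \<in> set (base_relators a b)" for w m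
    using rel[OF that] by (simp only: P.word_val_power)
  have val2: "letter P g \<otimes>\<^bsub>P\<^esub> letter P h = word_val P [g, h]" for g h
    by (simp add: word_val_Cons)
  have eq: "letter P g = letter P h \<longleftrightarrow> step T g 0 = step T h 0" for g h
    using word_problem[of "[g]" "[h]"] by (simp add: P.word_val_single)
  from dist have dist': "distinct (map (letter P) [Gx, Gy, Gs, Gt])"
    by (simp del: letter.simps add: eq)
  have "step T g 0 \<noteq> 0" for g
    using dist by (cases g) auto
  then have ord2: "P.ord (letter P g) = 2" for g
    using ord_word[of 2 "[g]"] by (simp add: P.word_val_single P.letter_square numeral_2_eq_2)
  show ?thesis
  proof (rule edge_biregular_map.intro[OF P.is_group], unfold_locales)
    show "generate P (set (eb_gens P)) = carrier P"
      by (simp add: set_eb_gens P.generate_letters)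
    show "distinct (eb_gens P)"
      using dist' by (simp add: eb_gens_def)
    show "P.ord (eb_t P \<otimes>\<^bsub>P\<^esub> eb_y P) = 2 * a div 2"
      using ord_word[OF ab(1) pow ty] val2[of Gt Gy] by (simp add: base_relators_def)
    show "P.ord (eb_s P \<otimes>\<^bsub>P\<^esub> eb_x P) = 2 * b div 2"
      using ord_word[OF ab(2) pow sx] val2[of Gs Gx] by (simp add: base_relators_def)
    show "(eb_x P \<otimes>\<^bsub>P\<^esub> eb_y P) [^]\<^bsub>P\<^esub> (2::nat) = \<one>\<^bsub>P\<^esub>"
      using pow[where w = "[Gx, Gy]" and m = 2] val2[of Gx Gy] by (simp add: base_relators_def)
    show "(eb_s P \<otimes>\<^bsub>P\<^esub> eb_t P) [^]\<^bsub>P\<^esub> (2::nat) = \<one>\<^bsub>P\<^esub>"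
      using pow[where w = "[Gs, Gt]" and m = 2] val2[of Gs Gt] by (simp add: base_relators_def)
  qed (auto simp: finite_P set_eb_gens ord2)
qed

end

text \<open>
  The parity of the length of a word is invariant under cancellation, and under deletion of relators as
  soon as these have even length. A relator of odd length is itself a witness of non-orientability.
\<close>

lemma orientable_presented_map_iff:
  assumes "set squares \<subseteq> set rels"
  shows "orientable (presented_map rels) \<longleftrightarrow> list_all (\<lambda>r. even (length r)) rels"
proof -
  let ?P = "presented_map rels"
  have word: "foldr (\<otimes>\<^bsub>?P\<^esub>) (map (letter ?P) w) \<one>\<^bsub>?P\<^esub> = word_val ?P w" for w
    by (simp add: word_val_def foldr_map comp_def)
  have "lists (set (eb_gens ?P)) = map (letter ?P) ` UNIV"
    by (simp add: set_eb_gens lists_image)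
  then have "orientable ?P \<longleftrightarrow> (\<forall>w. odd (length w) \<longrightarrow> word_val ?P w \<noteq> \<one>\<^bsub>?P\<^esub>)"
    by (simp add: orientable_def word)
  also have "\<dots> \<longleftrightarrow> list_all (\<lambda>r. even (length r)) rels"
  proof
    show "list_all (\<lambda>r. even (length r)) rels" if "\<forall>w. odd (length w) \<longrightarrow> word_val ?P w \<noteq> \<one>\<^bsub>?P\<^esub>"
      using that satisfies_presented_map[of rels] by (auto simp: list_all_iff satisfies_def)
  next
    assume even: "list_all (\<lambda>r. even (length r)) rels"
    have parity: "even (length u) = even (length v)" if "pres_eq (relator_words rels) u v" for u v
      using that by induction (use even in \<open>auto simp: list_all_iff positive_word_def\<close>)
    show "\<forall>w. odd (length w) \<longrightarrow> word_val ?P w \<noteq> \<one>\<^bsub>?P\<^esub>"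
      using parity by (force simp: word_val_presented_map presented_map_simps presented_group_simps
          pres_class_eq_iff positive_word_def)
  qed
  finally show ?thesis .
qed

section \<open>The twelve groups\<close>

text \<open>
  The tables list the elements of each group breadth-first, starting with the unit. They were found by
  coset enumeration over the trivial subgroup; that they are correct is what the certificates below
  establish.
\<close>

definition cayley_tables :: "nat list list list" where
  "cayley_tables =
   [[[1,0,5,7,6,2,4,3],
      [2,5,0,6,7,1,3,4],
      [3,6,7,0,5,4,1,2],
      [4,7,6,5,0,3,2,1]],
     [[1,0,4,7,2,10,11,3,9,8,5,6],
      [2,4,0,8,1,11,10,9,3,7,6,5],
      [3,5,6,0,9,1,2,11,10,4,8,7],
      [4,2,1,9,0,6,5,8,7,3,11,10]],
     [[1,0,5,8,9,2,10,11,3,4,6,7],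
      [2,5,0,9,8,1,11,10,4,3,7,6],
      [3,6,7,0,5,4,1,2,10,11,8,9],
      [4,7,6,5,0,3,2,1,11,10,9,8]],
     [[1,0,5,8,7,2,11,4,3,12,14,6,9,15,10,13],
      [2,5,0,6,9,1,3,12,11,4,13,8,7,10,15,14],
      [3,6,8,0,10,11,1,13,2,14,4,5,15,7,9,12],
      [4,7,9,10,0,12,13,1,14,2,3,15,5,6,8,11]],
     [[1,0,5,10,7,2,8,4,6,12,3,15,9,14,13,11],
      [2,5,0,8,9,1,10,12,3,4,6,14,7,15,11,13],
      [3,6,8,0,11,10,1,13,2,14,5,4,15,7,9,12],
      [4,7,9,11,0,12,13,1,14,2,15,3,5,6,8,10]],
     [[1,0,5,10,12,2,8,9,6,7,3,13,4,11,15,14],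
      [2,5,0,8,9,1,10,12,3,4,6,14,7,15,11,13],
      [3,6,8,0,11,10,1,13,2,14,5,4,15,7,9,12],
      [4,7,9,11,0,12,13,1,14,2,15,3,5,6,8,10]],
     [[1,0,5,10,7,2,14,4,15,13,3,12,11,9,6,8],
      [2,5,0,8,9,1,12,13,3,4,15,14,6,7,11,10],
      [3,6,8,0,11,12,1,15,2,14,13,4,5,10,9,7],
      [4,7,9,11,0,13,15,1,14,2,12,3,10,5,8,6]],
     [[1,0,5,10,12,2,9,8,7,6,3,13,4,11,15,14],
      [2,5,0,8,9,1,12,10,3,4,7,14,6,15,11,13],
      [3,6,8,0,11,12,1,13,2,14,15,4,5,7,9,10],
      [4,7,9,11,0,10,13,1,14,2,5,3,15,6,8,12]],
     [[1,0,5,8,9,2,10,11,3,4,6,7,14,15,12,13],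
      [2,5,0,4,3,1,7,6,9,8,11,10,13,12,15,14],
      [3,6,4,0,2,7,1,5,12,13,14,15,8,9,10,11],
      [4,7,3,2,0,6,5,1,13,12,15,14,9,8,11,10]],
     [[1,0,5,10,13,2,15,9,18,7,3,19,20,4,21,6,22,23,8,11,12,14,16,17],
      [2,5,0,11,9,1,16,13,12,4,19,3,8,7,17,22,6,14,20,10,18,23,15,21],
      [3,6,8,0,12,14,1,17,2,11,15,9,4,16,5,10,13,7,21,23,22,18,20,19],
      [4,7,9,12,0,13,17,1,11,2,18,8,3,5,16,21,14,6,10,20,19,15,23,22]],
     [[1,0,5,10,7,2,15,4,16,14,3,13,19,11,9,6,8,22,23,12,21,20,17,18],
      [2,5,0,11,9,1,16,14,15,4,13,3,20,10,7,8,6,23,22,21,12,19,18,17],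
      [3,6,8,0,12,13,1,17,2,18,15,16,4,5,21,10,11,7,9,22,23,14,19,20],
      [4,7,9,12,0,14,17,1,18,2,19,20,3,21,5,22,23,6,8,10,11,13,15,16]],
     [[1,0,5,10,7,2,14,4,16,13,3,18,19,9,6,21,8,22,11,12,23,15,17,20],
      [2,5,0,8,9,1,12,13,3,4,16,17,6,7,19,20,10,11,22,14,15,23,18,21],
      [3,6,8,0,11,12,1,15,2,17,14,4,5,20,10,7,19,9,21,16,13,18,23,22],
      [4,7,9,11,0,13,15,1,17,2,18,3,20,5,21,6,22,8,10,23,12,14,16,19]]]"

definition H2_orders :: "nat list" where
  "H2_orders = [8, 12, 12, 16, 16, 16, 16, 16, 16, 24, 24, 24]"

text \<open>
  Half the type: the orders of \<open>ty\<close> and \<open>sx\<close>.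
\<close>

definition H2_types :: "(nat \<times> nat) list" where
  "H2_types = [(4, 4), (2, 6), (3, 3), (2, 4), (2, 4), (2, 4), (2, 4), (2, 4), (2, 4),
               (2, 3), (2, 3), (2, 3)]"

definition H2_data :: "(nat \<times> gen list list \<times> (nat \<times> nat) \<times> nat \<times> nat list list) list" where
  "H2_data = zip [1..<13] (zip H2_relators (zip H2_types (zip H2_orders cayley_tables)))"

lemma H2_lengths:
  "length H2_relators = 12" "length H2_types = 12" "length H2_orders = 12" "length cayley_tables = 12"
  by (simp_all add: H2_relators_def H2_types_def H2_orders_def cayley_tables_def)

lemma H2_data_nth:
  "k < 12 \<Longrightarrow>
    H2_data ! k = (Suc k, H2_relators ! k, H2_types ! k, H2_orders ! k, cayley_tables ! k)"
  "length H2_data = 12"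
  by (simp_all add: H2_data_def H2_lengths del: upt_Suc)

lemma H2_dataD:
  assumes "list_all p H2_data" "i \<in> {1..12}"
  shows "p (i, H2_relators ! (i - 1), H2_types ! (i - 1), H2_orders ! (i - 1), cayley_tables ! (i - 1))"
  using assms H2_data_nth(1)[of "i - 1"] by (auto simp: list_all_length H2_data_nth(2) dest: spec[of _ "i - 1"])

lemma H2_tables_certified: "list_all (\<lambda>(i, rels, ab, n, T). cayley_table rels n T) H2_data"
  by code_simp

lemma H2_types_certified:
  "list_all (\<lambda>(i, rels, (a, b), n, T). 0 < a \<and> 0 < b \<and> list_all (\<lambda>r. r \<in> set rels) (base_relators a b) \<and>
     distinct (map (\<lambda>w. walk T w 0) [[], [Gx], [Gy], [Gs], [Gt]]) \<and>
     list_all (\<lambda>m. walk T ([Gt, Gy] \<up> m) 0 \<noteq> 0) [1..<a] \<and>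
     list_all (\<lambda>m. walk T ([Gs, Gx] \<up> m) 0 \<noteq> 0) [1..<b]) H2_data"
  by code_simp

lemma H2_distinguished:
  "list_all (\<lambda>(i, rels, ab, n, T). list_all (\<lambda>(j, rels', _). i = j \<or>
     list_all (\<lambda>\<sigma>. list_ex (\<lambda>r. walk T (map \<sigma> r) 0 \<noteq> 0) rels') relabellings) H2_data) H2_data"
  by code_simp

lemma H2_twins:
  "list_all (\<lambda>(i, rels, ab, n, T).
     list_all (\<lambda>r. walk T (map twin_gen r) 0 = 0) rels = (i \<in> {1, 3, 7, 10, 12})) H2_data"
  by code_simp

lemma H2_duals:
  "list_all (\<lambda>(i, rels, ab, n, T).
     list_all (\<lambda>r. walk T (map dual_gen r) 0 = 0) rels = (i \<in> {1, 3})) H2_data"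
  by code_simp

lemma H2_parities:
  "list_all (\<lambda>(i, rels, _). list_all (\<lambda>r. even (length r)) rels = (i \<in> {1, 3, 4, 7, 11, 12})) H2_data"
  by code_simp

lemma H2_table:
  "i \<in> {1..12} \<Longrightarrow>
    certified_cayley_table (H2_relators ! (i - 1)) (H2_orders ! (i - 1)) (cayley_tables ! (i - 1))"
  using H2_dataD[OF H2_tables_certified] by (simp add: certified_cayley_table_def)

lemma
  assumes i: "i \<in> {1..12}"
  shows marked_group_H2: "marked_group (H2 i)"
    and order_H2: "order (H2 i) = H2_orders ! (i - 1)"
    and edge_biregular_map_H2:
      "edge_biregular_map (H2 i) (2 * fst (H2_types ! (i - 1))) (2 * snd (H2_types ! (i - 1)))"
    and orientable_H2: "orientable (H2 i) \<longleftrightarrow> i \<in> {1, 3, 4, 7, 11, 12}"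
    and fully_regular_H2: "fully_regular (H2 i) \<longleftrightarrow> i \<in> {1, 3, 7, 10, 12}"
    and self_dual_H2: "self_dual (H2 i) \<longleftrightarrow> i \<in> {1, 3}"
proof -
  interpret certified_cayley_table "H2_relators ! (i - 1)" "H2_orders ! (i - 1)" "cayley_tables ! (i - 1)"
    by (rule H2_table) fact
  have H2_P: "H2 i = P" by (simp add: H2_def)
  show "marked_group (H2 i)" "order (H2 i) = H2_orders ! (i - 1)"
    unfolding H2_P by (rule P.marked_group_axioms, rule order_P)
  show "edge_biregular_map (H2 i) (2 * fst (H2_types ! (i - 1))) (2 * snd (H2_types ! (i - 1)))"
    using H2_dataD[OF H2_types_certified i] unfolding H2_P case_prod_unfold
    by (intro presented_edge_biregular_map) simp_all
  show "orientable (H2 i) \<longleftrightarrow> i \<in> {1, 3, 4, 7, 11, 12}"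
    using H2_dataD[OF H2_parities i] orientable_presented_map_iff[OF squares_subset]
    unfolding H2_P by simp
  show "fully_regular (H2 i) \<longleftrightarrow> i \<in> {1, 3, 7, 10, 12}"
    using H2_dataD[OF H2_twins i] map_iso_relabel_iff[of twin_gen]
    unfolding H2_P by (simp add: fully_regular_def twin_eq_relabel relabellings_def)
  show "self_dual (H2 i) \<longleftrightarrow> i \<in> {1, 3}"
    using H2_dataD[OF H2_duals i] map_iso_relabel_iff[of dual_gen]
    unfolding H2_P by (simp add: self_dual_def dual_eq_relabel relabellings_def)
qed

lemma H2_pairwise_distinct:
  assumes i: "i \<in> {1..12}" and j: "j \<in> {1..12}" and "i \<noteq> j"
  shows "\<not> iso_up_to_dual_twin (H2 i) (H2 j)"
proof -
  interpret certified_cayley_table "H2_relators ! (i - 1)" "H2_orders ! (i - 1)" "cayley_tables ! (i - 1)"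
    by (rule H2_table) fact
  have "list_all (\<lambda>(j, rels', _). i = j \<or>
      list_all (\<lambda>\<sigma>. list_ex (\<lambda>r. walk (cayley_tables ! (i - 1)) (map \<sigma> r) 0 \<noteq> 0) rels') relabellings) H2_data"
    using H2_dataD[OF H2_distinguished i] by simp
  from H2_dataD[OF this j] \<open>i \<noteq> j\<close>
  have "\<not> iso_up_to_dual_twin P (H2 j)"
    using satisfies_presented_map[of "H2_relators ! (j - 1)"]
    by (intro not_iso_up_to_dual_twin[where rels' = "H2_relators ! (j - 1)"] marked_group_H2 j)
      (simp_all add: H2_def)
  then show ?thesis by (simp add: H2_def)
qed

section \<open>The isomorphism types of the groups\<close>

definition marked :: "('a, 'm) monoid_scheme \<Rightarrow> (gen \<Rightarrow> 'a) \<Rightarrow> 'a ebmap" where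
  "marked G f = \<lparr>carrier = carrier G, monoid.mult = monoid.mult G, one = one G,
                 eb_x = f Gx, eb_y = f Gy, eb_s = f Gs, eb_t = f Gt\<rparr>"

lemma marked_simps [simp]:
  "carrier (marked G f) = carrier G" "monoid.mult (marked G f) = monoid.mult G"
  "one (marked G f) = one G" "letter (marked G f) g = f g"
  by (simp_all add: marked_def, cases g, simp_all)

text \<open>
  Evaluation with the product and the unit as explicit arguments, so that it can be computed from a
  closed formula for the product.
\<close>

definition word_eval :: "('a \<Rightarrow> 'a \<Rightarrow> 'a) \<Rightarrow> 'a \<Rightarrow> (gen \<Rightarrow> 'a) \<Rightarrow> gen list \<Rightarrow> 'a" where
  "word_eval mul e f w = foldr (\<lambda>g. mul (f g)) w e"

lemma word_val_marked: "word_val (marked G f) w = word_eval (monoid.mult G) (one G) f w"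
  by (simp add: word_val_def word_eval_def)

text \<open>
  Von Dyck's theorem gives a homomorphism to \<open>G\<close>. Every element of the presented group is the value of a
  tree word, so the kernel is trivial if no tree word but the empty one is sent to the unit; a count of
  elements then gives surjectivity.
\<close>

theorem (in certified_cayley_table) presented_map_is_iso:
  assumes "group G" and cl: "\<And>g. f g \<in> carrier G" and ord: "order G = n"
    and rel: "\<And>r. r \<in> set rels \<Longrightarrow> word_eval (monoid.mult G) (one G) f r = one G"
    and tree: "\<And>j. 0 < j \<Longrightarrow> j < n \<Longrightarrow> word_eval (monoid.mult G) (one G) f (tree_word T j) \<noteq> one G"
  shows "P \<cong> G"
proof -
  let ?M = "marked G f"
  have group: "group ?M"
    by (rule group_same_structure[OF \<open>group G\<close>]) simp_all
  have sq: "f g \<otimes>\<^bsub>G\<^esub> f g = \<one>\<^bsub>G\<^esub>" for g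
    using rel[of "[g, g]"] squares_subset group.is_monoid[OF \<open>group G\<close>] cl
    by (auto simp: word_eval_def set_squares monoid.r_one)
  interpret M: marked_involutions ?M
    using group by (simp add: marked_involutions_def marked_involutions_axioms_def cl sq)
  have "satisfies ?M rels"
    by (simp add: satisfies_def word_val_marked rel)
  then obtain h where h: "h \<in> hom P ?M" "\<And>g. h (letter P g) = letter ?M g"
    using von_dyck[OF M.marked_involutions_axioms] by blast
  interpret h: group_hom P ?M h
    using h(1) by (simp add: group_hom_def group_hom_axioms_def P.is_group group)
  have "a = \<one>\<^bsub>P\<^esub>" if a: "a \<in> carrier P" "h a = \<one>\<^bsub>?M\<^esub>" for a
  proof -
    obtain j where j: "j < n" "a = val j"
      using a(1) by (auto simp: carrier_eq_val)
    then have "word_val ?M (tree_word T j) = \<one>\<^bsub>?M\<^esub>"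
      using a(2) hom_word_val[OF P.marked_involutions_axioms group h] by (simp add: val_def)
    then have "j = 0"
      using tree[of j] j(1) by (auto simp: word_val_marked)
    with j show ?thesis by simp
  qed
  then have inj: "inj_on h (carrier P)"
    using h.inj_on_one_iff by blast
  have "card (h ` carrier P) = card (carrier ?M)"
    using card_image[OF inj] order_P ord by (simp add: order_def)
  moreover have "finite (carrier ?M)"
    using ord n_pos by (auto simp: order_def intro: card_ge_0_finite)
  moreover have "h ` carrier P \<subseteq> carrier ?M"
    by (intro image_subsetI h.hom_closed)
  ultimately have "h ` carrier P = carrier ?M"
    by (simp add: card_subset_eq)
  with inj h(1) have "h \<in> iso P G"
    by (auto simp: iso_def bij_betw_def hom_def)
  then show ?thesis
    by (auto simp: is_iso_def)
qed

definition faithful_images ::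
    "('a \<Rightarrow> 'a \<Rightarrow> 'a) \<Rightarrow> 'a \<Rightarrow> 'a list \<Rightarrow> gen list list \<Rightarrow> nat \<Rightarrow> nat list list \<Rightarrow> bool" where
  "faithful_images mul e xs rels n T \<longleftrightarrow>
     list_all (\<lambda>r. word_eval mul e (\<lambda>g. xs ! gen_index g) r = e) rels \<and>
     list_all (\<lambda>j. word_eval mul e (\<lambda>g. xs ! gen_index g) (tree_word T j) \<noteq> e) [1..<n]"

lemma (in certified_cayley_table) presented_map_is_iso_images:
  assumes "group G" "order G = n" "set xs \<subseteq> carrier G" "length xs = 4"
    and "faithful_images (monoid.mult G) (one G) xs rels n T"
  shows "P \<cong> G"
proof (rule presented_map_is_iso[OF assms(1), where f = "\<lambda>g. xs ! gen_index g"])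
  show "xs ! gen_index g \<in> carrier G" for g
    using assms(3,4) gen_index_less[of g] by (auto simp: subset_iff)
qed (use assms(2,5) in \<open>auto simp: faithful_images_def list_all_iff\<close>)


subsection \<open>The concrete groups\<close>

definition dihedral_mult :: "int \<Rightarrow> int \<times> bool \<Rightarrow> int \<times> bool \<Rightarrow> int \<times> bool" where
  "dihedral_mult m = (\<lambda>(a, p) (b, q). ((a + (if p then - b else b)) mod m, p \<noteq> q))"

definition pair_mult :: "('a \<Rightarrow> 'a \<Rightarrow> 'a) \<Rightarrow> ('b \<Rightarrow> 'b \<Rightarrow> 'b) \<Rightarrow> 'a \<times> 'b \<Rightarrow> 'a \<times> 'b \<Rightarrow> 'a \<times> 'b" where
  "pair_mult f g = (\<lambda>(a, b) (c, d). (f a c, g b d))"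

abbreviation add2 :: "int \<Rightarrow> int \<Rightarrow> int" where
  "add2 \<equiv> (\<lambda>x y. (x + y) mod 2)"

lemma dihedral_group_simps:
  "carrier (dihedral_group n) = {0..<int (n div 2)} \<times> UNIV"
  "monoid.mult (dihedral_group n) = dihedral_mult (int (n div 2))"
  "one (dihedral_group n) = (0, False)"
  by (simp_all add: dihedral_group_def dihedral_mult_def)

lemma group_dihedral_group:
  assumes "2 \<le> n"
  shows "group (dihedral_group n)"
proof (rule groupI)
  let ?m = "int (n div 2)"
  have m: "0 < ?m" using assms by simp
  fix u v w :: "int \<times> bool"
  show "u \<otimes>\<^bsub>dihedral_group n\<^esub> v \<in> carrier (dihedral_group n)"
    using m by (auto simp: dihedral_group_simps dihedral_mult_def split: prod.split)
  show "u \<otimes>\<^bsub>dihedral_group n\<^esub> v \<otimes>\<^bsub>dihedral_group n\<^esub> w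
      = u \<otimes>\<^bsub>dihedral_group n\<^esub> (v \<otimes>\<^bsub>dihedral_group n\<^esub> w)"
    by (cases u; cases v; cases w)
      (auto simp: dihedral_group_simps dihedral_mult_def mod_simps algebra_simps)
  assume u: "u \<in> carrier (dihedral_group n)"
  obtain a p where [simp]: "u = (a, p)" by (cases u)
  show "\<one>\<^bsub>dihedral_group n\<^esub> \<otimes>\<^bsub>dihedral_group n\<^esub> u = u"
    using u by (auto simp: dihedral_group_simps dihedral_mult_def)
  show "\<exists>v\<in>carrier (dihedral_group n). v \<otimes>\<^bsub>dihedral_group n\<^esub> u = \<one>\<^bsub>dihedral_group n\<^esub>"
    using u m by (intro bexI[of _ "(if p then a else (- a) mod ?m, p)"])
      (auto simp: dihedral_group_simps dihedral_mult_def mod_simps)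
qed (use assms in \<open>auto simp: dihedral_group_simps\<close>)

lemma order_dihedral_group: "order (dihedral_group n) = 2 * (n div 2)"
  by (simp add: order_def dihedral_group_simps card_cartesian_product)

lemma cyclic2_simps:
  "carrier cyclic2 = {0..<2}" "monoid.mult cyclic2 = add2" "one cyclic2 = 0"
  by (simp_all add: integer_mod_group_def fun_eq_iff)

lemma DirProd_simps:
  "monoid.mult (G \<times>\<times> H) = pair_mult (monoid.mult G) (monoid.mult H)"
  by (simp add: DirProd_def pair_mult_def)

lemma order_DirProd: "order (G \<times>\<times> H) = order G * order H"
  by (simp add: order_def card_cartesian_product)

lemma order_cyclic2: "order cyclic2 = 2"
  by (simp add: order_def cyclic2_simps)

fun sym_image :: "gen \<Rightarrow> nat \<Rightarrow> nat" where
  "sym_image Gx = transpose 3 4"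
| "sym_image Gy = transpose 1 2 \<circ> transpose 3 4"
| "sym_image Gs = transpose 2 3"
| "sym_image Gt = transpose 1 4 \<circ> transpose 2 3"

lemma permutes_eq_id_iff:
  "p permutes A \<Longrightarrow> p = id \<longleftrightarrow> (\<forall>a\<in>A. p a = a)"
  by (auto simp: fun_eq_iff permutes_not_in)

lemmas concrete_group_simps = dihedral_group_simps cyclic2_simps DirProd_simps
  order_DirProd order_cyclic2 order_dihedral_group

text \<open>
  Equality of functions on all natural numbers is not a finite question, but a permutation of
  \<open>{1..m}\<close> is the identity if it fixes these \<open>m\<close> points.
\<close>

lemma (in certified_cayley_table) presented_map_is_iso_sym_group:
  assumes "n = fact m" and f: "\<And>g. f g permutes {1..m}"
    and rel: "list_all (\<lambda>r. list_all (\<lambda>a. word_eval (\<circ>) id f r a = a) [1..<Suc m]) rels"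
    and tree: "list_all (\<lambda>j. list_ex (\<lambda>a. word_eval (\<circ>) id f (tree_word T j) a \<noteq> a) [1..<Suc m]) [1..<n]"
  shows "P \<cong> sym_group m"
proof (rule presented_map_is_iso[where f = f])
  have perm: "word_eval (\<circ>) id f w permutes {1..m}" for w
  proof (induction w)
    case (Cons g w)
    have "word_eval (\<circ>) id f (g # w) = f g \<circ> word_eval (\<circ>) id f w"
      by (simp only: word_eval_def foldr.simps o_apply)
    then show ?case
      using permutes_compose[OF Cons f[of g]] by (simp only:)
  next
    case Nil
    show ?case using permutes_id by (simp add: word_eval_def id_def)
  qed
  have id_iff: "word_eval (\<circ>) id f w = id \<longleftrightarrow> list_all (\<lambda>a. word_eval (\<circ>) id f w a = a) [1..<Suc m]" for w
    by (simp only: permutes_eq_id_iff[OF perm]) (auto simp: list_all_iff)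
  show "word_eval (\<otimes>\<^bsub>sym_group m\<^esub>) \<one>\<^bsub>sym_group m\<^esub> f r = \<one>\<^bsub>sym_group m\<^esub>" if "r \<in> set rels" for r
    using that rel by (simp add: sym_group_def id_iff list_all_iff)
  show "word_eval (\<otimes>\<^bsub>sym_group m\<^esub>) \<one>\<^bsub>sym_group m\<^esub> f (tree_word T j) \<noteq> \<one>\<^bsub>sym_group m\<^esub>"
    if "0 < j" "j < n" for j
    using that tree by (auto simp: sym_group_def id_iff list_all_iff list_ex_iff dest!: bspec[of _ _ j])
  show "f g \<in> carrier (sym_group m)" for g
    using f by (simp add: sym_group_def)
qed (use assms(1) in \<open>simp_all add: sym_group_is_group sym_group_card_carrier order_def\<close>)

text \<open>
  The images \<open>xss\<close> belong to consecutive groups, beginning with the one after number \<open>k\<close>.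
\<close>

lemma H2_images:
  assumes check: "list_all (\<lambda>(xs, i, rels, ab, n, T). faithful_images (monoid.mult G) (one G) xs rels n T)
      (zip xss (drop k H2_data))"
    and i: "k < i" "i \<le> 12" "i - Suc k < length xss"
    and G: "group G" "order G = H2_orders ! (i - 1)" "set (xss ! (i - Suc k)) \<subseteq> carrier G"
      "length (xss ! (i - Suc k)) = 4"
  shows "H2 i \<cong> G"
proof -
  interpret certified_cayley_table "H2_relators ! (i - 1)" "H2_orders ! (i - 1)" "cayley_tables ! (i - 1)"
    using H2_table[of i] i by simp
  have "faithful_images (monoid.mult G) (one G) (xss ! (i - Suc k)) (H2_relators ! (i - 1))
      (H2_orders ! (i - 1)) (cayley_tables ! (i - 1))"
    using check i by (auto simp: list_all_length H2_data_nth dest!: spec[of _ "i - Suc k"])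
  then show ?thesis
    using presented_map_is_iso_images G unfolding H2_def by blast
qed

subsection \<open>Generator images\<close>

text \<open>
  In all dihedral images \<open>x\<close> and \<open>s\<close> are reflections, chosen so that \<open>sx\<close> has the required order; the
  images of \<open>y\<close> and \<open>t\<close> are then found by solving the remaining relators.
\<close>

lemma H2_1_is_iso: "H2 1 \<cong> dihedral_group 8"
proof -
  let ?xss = "[[(0, True), (2, True), (1, True), (3, True)]] :: (int \<times> bool) list list"
  have check: "list_all (\<lambda>(xs, i, rels, ab, n, T). faithful_images (dihedral_mult 4) (0, False) xs rels n T)
      (zip ?xss (drop 0 H2_data))"
    by code_simp
  show ?thesis
    using H2_images[of "dihedral_group 8" ?xss 0 1] check
    by (simp add: concrete_group_simps group_dihedral_group H2_orders_def)
qed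

lemma H2_2_3_is_iso: "i \<in> {2, 3} \<Longrightarrow> H2 i \<cong> dihedral_group 12"
proof -
  let ?xss = "[[(0, True), (3, True), (1, True), (3, False)],
      [(0, True), (3, True), (2, True), (5, True)]] :: (int \<times> bool) list list"
  have check: "list_all (\<lambda>(xs, i, rels, ab, n, T). faithful_images (dihedral_mult 6) (0, False) xs rels n T)
      (zip ?xss (drop 1 H2_data))"
    by code_simp
  show "i \<in> {2, 3} \<Longrightarrow> H2 i \<cong> dihedral_group 12"
    using H2_images[of "dihedral_group 12" ?xss 1 i] check
    by (auto simp: concrete_group_simps group_dihedral_group H2_orders_def)
qed

lemma H2_4_to_9_is_iso: "i \<in> {4..9} \<Longrightarrow> H2 i \<cong> dihedral_group 8 \<times>\<times> cyclic2"
proof -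
  let ?G = "dihedral_group 8 \<times>\<times> cyclic2"
  let ?xss = "[[((0, True), 0), ((2, True), 0), ((1, True), 0), ((0, False), 1)],
     [((0, True), 0), ((2, False), 0), ((1, True), 0), ((0, False), 1)],
     [((0, True), 0), ((2, False), 0), ((1, True), 0), ((1, True), 1)],
     [((0, True), 0), ((0, False), 1), ((1, True), 0), ((2, False), 1)],
     [((0, True), 0), ((0, False), 1), ((1, True), 0), ((3, True), 1)],
     [((0, True), 0), ((0, False), 1), ((1, True), 0), ((1, True), 1)]] :: ((int \<times> bool) \<times> int) list list"
  assume i: "i \<in> {4..9}"
  have check: "list_all (\<lambda>(xs, i, rels, ab, n, T).
      faithful_images (pair_mult (dihedral_mult 4) add2) ((0, False), 0) xs rels n T)
      (zip ?xss (drop 3 H2_data))"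
    by code_simp
  have G: "group ?G"
    by (intro DirProd_group group_dihedral_group group_integer_mod_group) simp
  have "i \<in> {4, 5, 6, 7, 8, 9}" using i by auto
  then show ?thesis
    using H2_images[of ?G ?xss 3 i] check G
    by (auto simp: concrete_group_simps H2_orders_def)
qed

lemma H2_10_is_iso: "H2 10 \<cong> sym_group 4"
proof -
  interpret certified_cayley_table "H2_relators ! 9" "H2_orders ! 9" "cayley_tables ! 9"
    using H2_table[of 10] by simp
  have "list_all (\<lambda>r. list_all (\<lambda>a. word_eval (\<circ>) id sym_image r a = a) [1..<Suc 4]) (H2_relators ! 9)"
    by code_simp
  moreover have "list_all (\<lambda>j. list_ex (\<lambda>a. word_eval (\<circ>) id sym_image (tree_word (cayley_tables ! 9) j) a \<noteq> a)
      [1..<Suc 4]) [1..<H2_orders ! 9]"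
    by code_simp
  moreover have "sym_image g permutes {1..4}" for g
    by (cases g) (auto intro!: permutes_compose permutes_swap_id)
  moreover have "H2_orders ! 9 = fact 4"
    by (simp add: H2_orders_def fact_numeral)
  ultimately show ?thesis
    using presented_map_is_iso_sym_group[of 4 sym_image] by (simp add: H2_def)
qed

lemma H2_11_12_is_iso: "i \<in> {11, 12} \<Longrightarrow> H2 i \<cong> dihedral_group 6 \<times>\<times> klein_four"
proof -
  let ?G = "dihedral_group 6 \<times>\<times> klein_four"
  let ?xss = "[[((0, True), (0, 0)), ((0, True), (0, 1)), ((1, True), (0, 0)), ((0, False), (1, 0))],
     [((0, True), (0, 0)), ((0, False), (0, 1)), ((1, True), (0, 0)), ((0, False), (1, 0))]]
     :: ((int \<times> bool) \<times> int \<times> int) list list"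
  assume i: "i \<in> {11, 12}"
  have check: "list_all (\<lambda>(xs, i, rels, ab, n, T).
      faithful_images (pair_mult (dihedral_mult 3) (pair_mult add2 add2)) ((0, False), 0, 0) xs rels n T)
      (zip ?xss (drop 10 H2_data))"
    by code_simp
  have G: "group ?G"
    by (intro DirProd_group group_dihedral_group group_integer_mod_group) simp
  show ?thesis
    using H2_images[of ?G ?xss 10 i] check G i
    by (auto simp: concrete_group_simps H2_orders_def)
qed

section \<open>Edge-biregular maps and their face stabilisers\<close>

text \<open>
  The assumptions on a map in terms of words, with the orders \<open>a\<close> of \<open>ty\<close> and \<open>b\<close> of \<open>sx\<close> in place of the
  type \<open>(2a, 2b)\<close>.
\<close>

locale biregular = marked_group M for M :: "'a ebmap" (structure) and a b :: nat +
  assumes finite_carrier: "finite (carrier M)"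
    and letters_distinct: "distinct (map (letter M) [Gx, Gy, Gs, Gt])"
    and letter_ne_one: "letter M g \<noteq> \<one>"
    and xy_rel: "word_val M [Gx, Gy, Gx, Gy] = \<one>"
    and st_rel: "word_val M [Gs, Gt, Gs, Gt] = \<one>"
    and ord_ty: "ord (word_val M [Gt, Gy]) = a"
    and ord_sx: "ord (word_val M [Gs, Gx]) = b"

lemma edge_biregular_map_biregular:
  fixes M :: "'a ebmap" (structure)
  assumes "edge_biregular_map M k l"
  shows "biregular M (k div 2) (l div 2)"
proof -
  interpret edge_biregular_map M k l by fact
  interpret marked_group M by (rule edge_biregular_map_marked) fact
  have square: "word_val M [g, h, g, h] = (letter M g \<otimes> letter M h) [^] (2::nat)" for g h
    by (simp add: word_val_Cons numeral_2_eq_2 m_assoc)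
  show ?thesis
  proof
    show "letter M g \<noteq> \<one>" for g
      using gens_involution[of "letter M g"] by (auto simp: set_eb_gens)
    show "distinct (map (letter M) [Gx, Gy, Gs, Gt])"
      using gens_distinct by (simp add: eb_gens_def)
    show "word_val M [Gx, Gy, Gx, Gy] = \<one>" "word_val M [Gs, Gt, Gs, Gt] = \<one>"
      using xy_relation st_relation by (simp_all add: square)
    show "ord (word_val M [Gt, Gy]) = k div 2" "ord (word_val M [Gs, Gx]) = l div 2"
      using ord_ty ord_sx letter_closed[of Gy] letter_closed[of Gx] by (simp_all add: word_val_Cons)
  qed (rule fin)
qed

declare letter.simps [simp del]

context biregular
begin

lemma letter_letter [simp]: "u \<in> carrier M \<Longrightarrow> letter M g \<otimes> (letter M g \<otimes> u) = u"
  by (simp add: letter_square flip: m_assoc)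

lemma inv_letter [simp]: "inv (letter M g) = letter M g"
  by (simp add: inv_equality letter_square)

lemma letters_commute:
  assumes "word_val M [g, h, g, h] = \<one>"
  shows "letter M g \<otimes> letter M h = letter M h \<otimes> letter M g"
proof -
  have "(letter M g \<otimes> letter M h) \<otimes> (letter M g \<otimes> letter M h) = \<one>"
    using assms by (simp add: word_val_Cons m_assoc)
  then have "inv (letter M g \<otimes> letter M h) = letter M g \<otimes> letter M h"
    by (simp add: inv_equality)
  then show ?thesis by (simp add: inv_mult_group)
qed

lemma xy_commute: "letter M Gx \<otimes> letter M Gy = letter M Gy \<otimes> letter M Gx"
  and st_commute: "letter M Gs \<otimes> letter M Gt = letter M Gt \<otimes> letter M Gs"
  by (rule letters_commute[OF xy_rel], rule letters_commute[OF st_rel])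

lemma ord_ge_2:
  assumes "g \<noteq> h"
  shows "2 \<le> ord (word_val M [g, h])"
proof -
  have "word_val M [g, h] \<noteq> \<one>"
  proof
    assume "word_val M [g, h] = \<one>"
    then have "inv (letter M h) = letter M g"
      by (intro inv_equality) (simp_all add: word_val_Cons)
    with letters_distinct assms show False
      by (cases g; cases h) auto
  qed
  then have "ord (word_val M [g, h]) \<noteq> 1"
    using ord_eq_1[of "word_val M [g, h]"] by auto
  moreover have "0 < ord (word_val M [g, h])"
    using ord_ge_1[OF finite_carrier, of "word_val M [g, h]"] by simp
  ultimately show ?thesis by linarith
qed

lemma a_ge_2: "2 \<le> a" and b_ge_2: "2 \<le> b"
  using ord_ge_2[of Gt Gy] ord_ge_2[of Gs Gx] ord_ty ord_sx by simp_all

lemma biregular_twin: "biregular (relabel twin_gen M) a b"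
  and biregular_dual: "biregular (relabel dual_gen M) b a"
proof -
  have rel: "marked_group (relabel twin_gen M)" "marked_group (relabel dual_gen M)"
    using marked_group_relabel[OF marked_group_axioms] by (simp_all add: relabellings_def)
  have ord_swap: "ord (word_val M [g, h]) = ord (word_val M [h, g])" for g h
    using ord_inv[of "word_val M [g, h]"] by (simp add: word_val_Cons inv_mult_group)
  have ord_rel: "group.ord (relabel \<sigma> M) z = ord z" for \<sigma> z
  proof -
    have "z [^]\<^bsub>relabel \<sigma> M\<^esub> (m::nat) = z [^] m" for m
      by (induction m) simp_all
    then show ?thesis
      using group.ord_def[OF group_relabel[OF is_group]] by (simp add: ord_def)
  qed
  have comm: "word_val M [Gy, Gx, Gy, Gx] = \<one>" "word_val M [Gt, Gs, Gt, Gs] = \<one>"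
    using word_val_rev[of "[Gx, Gy, Gx, Gy]"] word_val_rev[of "[Gs, Gt, Gs, Gt]"] xy_rel st_rel by simp_all
  show "biregular (relabel twin_gen M) a b"
    unfolding biregular_def biregular_axioms_def ord_rel word_val_relabel
    using rel finite_carrier letters_distinct letter_ne_one xy_rel st_rel comm ord_ty ord_sx ord_swap[of Gt] ord_swap[of Gs]
    by auto
  show "biregular (relabel dual_gen M) b a"
    unfolding biregular_def biregular_axioms_def ord_rel word_val_relabel
    using rel finite_carrier letters_distinct letter_ne_one xy_rel st_rel comm ord_ty ord_sx ord_swap[of Gt] ord_swap[of Gs]
    by auto
qed


subsection \<open>The dihedral face stabiliser\<close>

definition rot :: 'a where
  "rot = letter M Gs \<otimes> letter M Gx"

text \<open>
  The codes \<open>(i, e)\<close> multiply by \<open>dihedral_mult\<close>, as the elements of the concrete dihedral groups do.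
\<close>

definition face :: "int \<times> bool \<Rightarrow> 'a" where
  "face = (\<lambda>(i, e). rot [^] i \<otimes> (if e then letter M Gx else \<one>))"

definition face_codes :: "(int \<times> bool) set" where
  "face_codes = {0..<int b} \<times> UNIV"

lemma rot_closed [simp]: "rot \<in> carrier M"
  by (simp add: rot_def)

lemma face_closed [simp]: "face u \<in> carrier M"
  by (simp add: face_def split: prod.split)

lemma face_letters: "face (0, True) = letter M Gx" "face (1, True) = letter M Gs" "face (0, False) = \<one>"
  by (simp_all add: face_def rot_def m_assoc letter_square)

lemma ord_rot: "ord rot = b"
  using ord_sx by (simp add: rot_def word_val_Cons)

text \<open>
  The involution \<open>x\<close> inverts the rotation \<open>sx\<close>, because \<open>x(sx)x = xs\<close>.
\<close>

lemma x_rot_pow: "letter M Gx \<otimes> rot [^] i = rot [^] (- i) \<otimes> letter M Gx" for i :: int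
proof -
  have nat: "letter M Gx \<otimes> rot [^] n = inv (rot [^] n) \<otimes> letter M Gx" for n :: nat
  proof (induction n)
    case (Suc n)
    have "letter M Gx \<otimes> rot = inv rot \<otimes> letter M Gx"
      by (simp add: rot_def inv_mult_group m_assoc letter_square)
    then have "letter M Gx \<otimes> rot [^] Suc n = inv rot \<otimes> letter M Gx \<otimes> rot [^] n"
      using nat_pow_Suc2[of rot n] by (simp del: nat_pow_Suc flip: m_assoc)
    also have "\<dots> = inv rot \<otimes> (letter M Gx \<otimes> rot [^] n)"
      by (simp add: m_assoc)
    also have "\<dots> = inv (rot [^] Suc n) \<otimes> letter M Gx"
      by (simp add: Suc inv_mult_group m_assoc)
    finally show ?case .
  qed simp
  have "letter M Gx \<otimes> inv (rot [^] n) = rot [^] n \<otimes> letter M Gx" for n :: nat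
  proof -
    have "letter M Gx \<otimes> (letter M Gx \<otimes> rot [^] n) \<otimes> letter M Gx
        = letter M Gx \<otimes> (inv (rot [^] n) \<otimes> letter M Gx) \<otimes> letter M Gx"
      by (simp only: nat)
    then show ?thesis by (simp add: m_assoc letter_square)
  qed
  with nat show ?thesis
    by (cases i rule: int_cases2) (simp_all add: int_pow_int int_pow_neg_int)
qed

lemma rot_pow_mod: "rot [^] (i mod int b) = rot [^] i"
  using int_pow_eq[OF rot_closed, of "i mod int b" i] ord_rot by (simp add: dvd_minus_mod)

lemma face_mult: "face u \<otimes> face v = face (dihedral_mult (int b) u v)"
proof -
  obtain i e j f where uv: "u = (i, e)" "v = (j, f)" by (cases u; cases v)
  let ?w = "if f then letter M Gx else \<one>"
  show ?thesis
  proof (cases e)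
    case True
    have "face u \<otimes> face v = rot [^] i \<otimes> (letter M Gx \<otimes> rot [^] j) \<otimes> ?w"
      by (simp add: uv face_def True m_assoc)
    also have "\<dots> = (rot [^] i \<otimes> rot [^] (- j)) \<otimes> (letter M Gx \<otimes> ?w)"
      by (simp add: x_rot_pow m_assoc)
    also have "rot [^] i \<otimes> rot [^] (- j) = rot [^] ((i + - j) mod int b)"
      by (simp only: rot_pow_mod int_pow_mult[OF rot_closed])
    also have "letter M Gx \<otimes> ?w = (if e \<noteq> f then letter M Gx else \<one>)"
      by (simp add: True letter_square)
    finally show ?thesis
      by (simp add: uv face_def dihedral_mult_def True)
  next
    case False
    then have "face u \<otimes> face v = (rot [^] i \<otimes> rot [^] j) \<otimes> ?w"
      by (simp add: uv face_def m_assoc)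
    also have "rot [^] i \<otimes> rot [^] j = rot [^] ((i + j) mod int b)"
      by (simp only: rot_pow_mod int_pow_mult[OF rot_closed])
    finally show ?thesis
      by (simp add: uv face_def dihedral_mult_def False)
  qed
qed

text \<open>
  The \<open>2b\<close> products are distinct: if \<open>x\<close> were a power of the rotation \<open>r = sx\<close>, it would both commute with
  \<open>r\<close> and invert it, so \<open>r\<close> would have order \<open>2\<close> and \<open>x\<close> would be \<open>1\<close> or \<open>r\<close>, making \<open>x\<close> or \<open>s\<close> trivial.
\<close>

lemma face_inj: "inj_on face face_codes"
proof -
  have x_not_rot: "letter M Gx \<noteq> rot [^] i" for i :: int
  proof
    assume x: "letter M Gx = rot [^] i"
    have "letter M Gx \<otimes> rot = rot \<otimes> letter M Gx"
      unfolding x by (metis int_pow_1 int_pow_mult rot_closed add.commute)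
    then have "rot [^] (- 1::int) \<otimes> letter M Gx = rot [^] (1::int) \<otimes> letter M Gx"
      using x_rot_pow[of 1] by simp
    then have "rot [^] (- 1::int) = rot [^] (1::int)"
      by simp
    then have "int b dvd 2"
      using int_pow_eq[of rot "- 1" 1] ord_rot by simp
    then have "b = 2"
      using b_ge_2 zdvd_imp_le[of "int b" 2] by simp
    then have "letter M Gx = \<one> \<or> letter M Gx = rot"
      using x rot_pow_mod[of i] by (cases "even i") (auto simp: even_iff_mod_2_eq_zero odd_iff_mod_2_eq_one)
    then show False
      using letter_ne_one[of Gx] letter_ne_one[of Gs] by (auto simp: rot_def)
  qed
  have rot_inj: "i = j" if "rot [^] i = rot [^] j" "i \<in> {0..<int b}" "j \<in> {0..<int b}" for i j :: int
  proof -
    have "int b dvd j - i"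
      using that(1) int_pow_eq[OF rot_closed] ord_rot by metis
    then have "j mod int b = i mod int b"
      by (simp add: mod_eq_dvd_iff)
    with that(2,3) show ?thesis by simp
  qed
  show ?thesis
  proof (rule inj_onI)
    fix u v assume uv: "u \<in> face_codes" "v \<in> face_codes" "face u = face v"
    obtain i e j f where [simp]: "u = (i, e)" "v = (j, f)" by (cases u; cases v)
    have "e = f"
    proof (rule ccontr)
      assume "e \<noteq> f"
      then have "letter M Gx = inv (rot [^] i) \<otimes> rot [^] j \<or> letter M Gx = inv (rot [^] j) \<otimes> rot [^] i"
        using uv(3) by (auto simp: face_def inv_solve_left split: if_splits)
      then show False
        using x_not_rot by (auto simp flip: int_pow_neg int_pow_mult)
    qed
    with uv rot_inj show "u = v"
      by (auto simp: face_def face_codes_def split: if_splits)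
  qed
qed

definition face_group :: "'a set" where
  "face_group = face ` face_codes"

lemma dihedral_mult_codes [simp]: "dihedral_mult (int b) u v \<in> face_codes"
  using b_ge_2 by (auto simp: face_codes_def dihedral_mult_def split: prod.split)

lemma codes_letters [simp]: "(0, e) \<in> face_codes" "(1, e) \<in> face_codes"
  using b_ge_2 by (auto simp: face_codes_def)

lemma subgroup_face_group: "subgroup face_group M"
proof (rule subgroupI)
  fix z assume "z \<in> face_group"
  then obtain i e where z: "z = face (i, e)" "(i, e) \<in> face_codes"
    by (auto simp: face_group_def)
  let ?v = "if e then (i, True) else ((- i) mod int b, False)"
  have "?v \<in> face_codes"
    using z(2) b_ge_2 by (auto simp: face_codes_def)
  moreover have "face ?v \<otimes> z = \<one>"
    using b_ge_2 by (auto simp: z face_mult dihedral_mult_def mod_simps face_letters)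
  then have "inv z = face ?v"
    using z(1) by (simp add: inv_equality)
  ultimately show "inv z \<in> face_group"
    by (auto simp: face_group_def)
qed (use codes_letters(1)[of False] in \<open>auto simp: face_group_def face_mult simp del: codes_letters\<close>)

lemma card_face_group: "card face_group = 2 * b"
  using card_image[OF face_inj] by (simp add: face_group_def face_codes_def card_cartesian_product)

lemma x_in_face_group: "letter M Gx \<in> face_group" and s_in_face_group: "letter M Gs \<in> face_group"
  unfolding face_group_def by (metis codes_letters face_letters image_eqI)+

text \<open>
  This description is symmetric in \<open>x\<close> and \<open>s\<close>, which twinning interchanges.
\<close>

lemma face_group_eq_generate: "face_group = generate M {letter M Gx, letter M Gs}"
proof
  let ?N = "generate M {letter M Gx, letter M Gs}"
  have N: "subgroup ?N M" by (rule generate_is_subgroup) auto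
  have xs: "letter M Gx \<in> ?N" "letter M Gs \<in> ?N" by (auto intro: generate.incl)
  then have "rot \<in> ?N" unfolding rot_def by (intro subgroup.m_closed[OF N] xs)
  then have "rot [^] i \<in> ?N" for i :: int
    by (rule subgroup_int_pow_closed[OF N])
  then show "face_group \<subseteq> ?N"
    using xs N by (auto simp: face_group_def face_def intro!: subgroup.m_closed[OF N] subgroup.one_closed[OF N])
  show "?N \<subseteq> face_group"
    using x_in_face_group s_in_face_group by (intro generate_subgroup_incl subgroup_face_group) auto
qed

lemma order_dvd: "2 * b dvd order M"
  using lagrange[OF subgroup_face_group] card_face_group by (metis dvd_triv_right)

end

section \<open>Recognising a map from its coordinates\<close>

definition classified :: "'a ebmap \<Rightarrow> bool" where
  "classified M \<longleftrightarrow> (\<exists>i<12. \<exists>\<sigma>\<in>set relabellings.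
     order M = H2_orders ! i \<and> satisfies (relabel \<sigma> M) (H2_relators ! i))"

lemma relabellings_compose:
  assumes "\<sigma> \<in> set relabellings" "\<tau> \<in> set relabellings"
  shows "\<sigma> \<circ> \<tau> \<in> set relabellings"
proof -
  have point: "twin_gen (twin_gen g) = g" "dual_gen (dual_gen g) = g"
    "dual_gen (twin_gen g) = twin_gen (dual_gen g)" for g
    by (cases g; simp)+
  have rules: "twin_gen \<circ> twin_gen = id" "dual_gen \<circ> dual_gen = id" "dual_gen \<circ> twin_gen = twin_gen \<circ> dual_gen"
    by (simp_all add: fun_eq_iff point)
  have rules': "twin_gen \<circ> (twin_gen \<circ> f) = f" "dual_gen \<circ> (twin_gen \<circ> f) = twin_gen \<circ> (dual_gen \<circ> f)"
    for f :: "gen \<Rightarrow> gen"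
    by (simp_all add: fun_eq_iff point)
  show ?thesis
    using assms unfolding relabellings_def by (auto simp: comp_assoc rules rules')
qed

lemma classified_relabel:
  assumes "\<tau> \<in> set relabellings" "classified (relabel \<tau> M)"
  shows "classified M"
  using assms relabellings_compose[OF assms(1)] unfolding classified_def relabel_relabel order_relabel
  by blast

text \<open>
  What can be said of the action of the generators on the coordinates \<open>n\<close> of the elements of a map by
  right multiplication. The list \<open>ns\<close> holds base points that represent all coordinates up to left
  multiplication, \<open>extra\<close> further relators of the map, and \<open>n0\<close> is the coordinate of the unit, at which
  distinctness and the order of \<open>ty\<close> can be tested because the action is regular.
\<close>

definition admissible :: "nat \<Rightarrow> nat \<Rightarrow> gen list list \<Rightarrow> (gen \<Rightarrow> 'n \<Rightarrow> 'n) \<Rightarrow> 'n list \<Rightarrow> 'n \<Rightarrow> bool" where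
  "admissible a b extra act ns n0 \<longleftrightarrow>
     list_all (\<lambda>r. list_all (\<lambda>n. fold act r n = n) ns) (base_relators a b @ extra) \<and>
     distinct (map (\<lambda>w. fold act w n0) [[], [Gx], [Gy], [Gs], [Gt]]) \<and>
     list_all (\<lambda>m. fold act ([Gt, Gy] \<up> m) n0 \<noteq> n0) [1..<a]"

definition recognised :: "gen list list list \<Rightarrow> (gen \<Rightarrow> 'n \<Rightarrow> 'n) \<Rightarrow> 'n \<Rightarrow> bool" where
  "recognised relss act n0 \<longleftrightarrow>
     list_ex (list_all (\<lambda>r. fold act r n0 = n0)) relss \<or>
     list_ex (list_all (\<lambda>r. fold act (map twin_gen r) n0 = n0)) relss"

definition codes :: "nat \<Rightarrow> (int \<times> bool) list" where
  "codes b = List.product (map int [0..<b]) [False, True]"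

lemma (in biregular) set_codes: "set (codes b) = face_codes"
  by (auto simp: codes_def face_codes_def image_int_atLeastLessThan)

lemma (in biregular) base_relators_hold: "r \<in> set (base_relators a b) \<Longrightarrow> word_val M r = \<one>"
proof -
  have sq: "word_val M [g, g] = \<one>" for g
    by (simp add: word_val_Cons letter_square)
  have "word_val M ([Gt, Gy] \<up> a) = \<one>" "word_val M ([Gs, Gx] \<up> b) = \<one>"
    using pow_ord_eq_1[of "word_val M [Gt, Gy]"] pow_ord_eq_1[of "word_val M [Gs, Gx]"]
    by (simp_all add: word_val_power ord_ty ord_sx)
  then show "r \<in> set (base_relators a b) \<Longrightarrow> word_val M r = \<one>"
    using sq xy_rel st_rel by (auto simp: base_relators_def numeral_2_eq_2)
qed

text \<open>
  Suppose that the elements of a map have coordinates in which right multiplication by the generators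
  is given by \<open>act\<close>. Then a word is trivial exactly if it fixes the coordinate of the unit, and in that
  case it fixes all coordinates, since right multiplication by the unit does. So the action is
  admissible, and recognising it identifies the group.
\<close>

lemma (in biregular) classified_by_action:
  assumes n0: "n0 \<in> A" "val n0 = \<one>" and inj: "inj_on val A" and cl: "\<And>n. val n \<in> carrier M"
    and act: "\<And>g n. n \<in> A \<Longrightarrow> act g n \<in> A" "\<And>g n. n \<in> A \<Longrightarrow> val n \<otimes> letter M g = val (act g n)"
    and ns: "set ns \<subseteq> A"
    and check: "\<not> admissible a b extra act ns n0 \<or> recognised relss act n0"
    and extra: "\<And>r. r \<in> set extra \<Longrightarrow> word_val M r = \<one>"
    and relss: "\<And>rels. rels \<in> set relss \<Longrightarrow> \<exists>i<12. rels = H2_relators ! i \<and> order M = H2_orders ! i"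
  shows "classified M"
proof -
  have fold_in: "n \<in> A \<Longrightarrow> fold act w n \<in> A" for w n
    by (induction w arbitrary: n) (simp_all add: act)
  have val_fold: "n \<in> A \<Longrightarrow> val n \<otimes> word_val M w = val (fold act w n)" for w n
    by (induction w arbitrary: n) (simp_all add: cl word_val_Cons act m_assoc[symmetric])
  have word_eq: "word_val M u = word_val M v \<longleftrightarrow> fold act u n0 = fold act v n0" for u v
    using val_fold[OF n0(1), of u] val_fold[OF n0(1), of v] fold_in[OF n0(1)] inj
    by (auto simp: n0(2) inj_on_eq_iff)
  have word_one: "word_val M w = \<one> \<longleftrightarrow> fold act w n0 = n0" for w
    using word_eq[of w "[]"] by simp
  have fix_node: "fold act w n = n" if "word_val M w = \<one>" "n \<in> A" for w n
    using val_fold[OF that(2), of w] that(1) fold_in[OF that(2)] inj that(2)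
    by (auto simp: cl dest: inj_onD)
  have "admissible a b extra act ns n0"
    unfolding admissible_def
  proof (intro conjI)
    show "list_all (\<lambda>r. list_all (\<lambda>n. fold act r n = n) ns) (base_relators a b @ extra)"
      using ns base_relators_hold extra fix_node by (auto simp: list_all_iff)
    have "letter M g = letter M h \<longleftrightarrow> fold act [g] n0 = fold act [h] n0"
      "letter M g = \<one> \<longleftrightarrow> fold act [g] n0 = n0" for g h
      by (simp_all only: word_val_single[symmetric] word_eq word_one)
    then show "distinct (map (\<lambda>w. fold act w n0) [[], [Gx], [Gy], [Gs], [Gt]])"
      using letters_distinct letter_ne_one by (simp add: eq_commute[of n0])
    show "list_all (\<lambda>m. fold act ([Gt, Gy] \<up> m) n0 \<noteq> n0) [1..<a]"
      unfolding list_all_iff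
    proof (intro ballI notI)
      fix m assume m: "m \<in> set [1..<a]" "fold act ([Gt, Gy] \<up> m) n0 = n0"
      then have "word_val M [Gt, Gy] [^] m = \<one>"
        by (simp only: word_one[symmetric] word_val_power)
      then have "a dvd m"
        using pow_eq_id[of "word_val M [Gt, Gy]" m] by (simp add: ord_ty)
      with m(1) show False by (auto dest: dvd_imp_le)
    qed
  qed
  with check have "recognised relss act n0" by blast
  then obtain rels \<sigma> where "rels \<in> set relss" and \<sigma>: "\<sigma> = id \<or> \<sigma> = twin_gen"
    and "\<forall>r\<in>set rels. fold act (map \<sigma> r) n0 = n0"
    unfolding recognised_def list_ex_iff list_all_iff by (metis list.map_id)
  moreover from \<sigma> have "\<sigma> \<in> set relabellings" by (auto simp: relabellings_def)
  ultimately have "satisfies (relabel \<sigma> M) rels"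
    by (simp add: satisfies_def word_val_relabel word_one)
  with relss[OF \<open>rels \<in> set relss\<close>] \<open>\<sigma> \<in> set relabellings\<close> show ?thesis
    unfolding classified_def by blast
qed

lemma (in biregular) face_mult_letter:
  "face u \<otimes> letter M Gx = face (dihedral_mult (int b) u (0, True))"
  "face u \<otimes> letter M Gs = face (dihedral_mult (int b) u (1, True))"
  by (simp_all add: face_mult flip: face_letters(1,2))

definition face_word :: "int \<times> bool \<Rightarrow> gen list" where
  "face_word = (\<lambda>(i, e). ([Gs, Gx] \<up> nat i) @ (if e then [Gx] else []))"

lemma (in biregular) word_val_face_word: "u \<in> face_codes \<Longrightarrow> word_val M (face_word u) = face u"
  by (auto simp: face_word_def face_def face_codes_def word_val_append word_val_power word_val_Cons
      rot_def elim!: nonneg_int_cases simp flip: int_pow_int)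

subsection \<open>One face\<close>

text \<open>
  With a single face the face stabiliser is the whole group; \<open>u\<close> and \<open>v\<close> are the unknown codes of \<open>y\<close> and \<open>t\<close>.
\<close>

fun whole_act :: "int \<Rightarrow> int \<times> bool \<Rightarrow> int \<times> bool \<Rightarrow> gen \<Rightarrow> int \<times> bool \<Rightarrow> int \<times> bool" where
  "whole_act m u v Gx n = dihedral_mult m n (0, True)"
| "whole_act m u v Gs n = dihedral_mult m n (1, True)"
| "whole_act m u v Gy n = dihedral_mult m n u"
| "whole_act m u v Gt n = dihedral_mult m n v"

lemma (in biregular) classified_one_face:
  assumes ord: "order M = 2 * b"
    and check: "list_all (\<lambda>u. list_all (\<lambda>v. \<not> admissible a b [] (whole_act (int b) u v) [(0, False)] (0, False) \<or>
        recognised relss (whole_act (int b) u v) (0, False)) (codes b)) (codes b)"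
    and relss: "\<And>rels. rels \<in> set relss \<Longrightarrow> \<exists>i<12. rels = H2_relators ! i \<and> order M = H2_orders ! i"
  shows "classified M"
proof -
  have "face_group = carrier M"
    using ord card_face_group subgroup.subset[OF subgroup_face_group] finite_carrier
    by (intro card_subset_eq) (auto simp: order_def)
  then obtain u v where uv: "u \<in> face_codes" "letter M Gy = face u" "v \<in> face_codes" "letter M Gt = face v"
    using letter_closed[of Gy] letter_closed[of Gt] unfolding face_group_def by (metis imageE)
  let ?act = "whole_act (int b) u v"
  show ?thesis
  proof (rule classified_by_action[where A = face_codes and val = face and act = ?act
        and ns = "[(0, False)]" and ?n0.0 = "(0, False)" and relss = relss and extra = "[]"])
    show "?act g n \<in> face_codes" for g n by (cases g) simp_all
    show "face n \<otimes> letter M g = face (?act g n)" for g n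
      by (cases g) (simp_all add: uv face_mult face_mult_letter)
    show "\<not> admissible a b [] ?act [(0, False)] (0, False) \<or> recognised relss ?act (0, False)"
      using check uv by (auto simp: list_all_iff set_codes)
  qed (use relss in \<open>auto simp: face_letters face_inj\<close>)
qed

subsection \<open>Two faces\<close>

text \<open>
  With two faces and \<open>t\<close> outside the face stabiliser \<open>N\<close>, every element is \<open>n t\<^sup>f\<close> with \<open>n \<in> N\<close>. As \<open>t\<close> commutes
  with \<open>s\<close>, right multiplication by \<open>s\<close>, \<open>x\<close> and \<open>t\<close> depends only on the code \<open>c\<close> of \<open>txt\<close>, which lies in the
  subgroup \<open>N\<close> of index two. The generator \<open>y\<close> is an unknown word \<open>yw\<close> in the other three; \<open>half_step\<close> is not
  meant to be applied to it.
\<close>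

fun half_step :: "int \<Rightarrow> int \<times> bool \<Rightarrow> gen \<Rightarrow> (int \<times> bool) \<times> bool \<Rightarrow> (int \<times> bool) \<times> bool" where
  "half_step m c Gx (u, f) = (dihedral_mult m u (if f then c else (0, True)), f)"
| "half_step m c Gs (u, f) = (dihedral_mult m u (1, True), f)"
| "half_step m c Gt (u, f) = (u, \<not> f)"
| "half_step m c Gy n = n"

definition half_act ::
    "int \<Rightarrow> int \<times> bool \<Rightarrow> gen list \<Rightarrow> gen \<Rightarrow> (int \<times> bool) \<times> bool \<Rightarrow> (int \<times> bool) \<times> bool" where
  "half_act m c yw g n = (if g = Gy then fold (half_step m c) yw n else half_step m c g n)"

definition half_words :: "nat \<Rightarrow> gen list list" where
  "half_words b = map (\<lambda>(u, f). face_word u @ (if f then [Gt] else [])) (List.product (codes b) [False, True])"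

text \<open>
  Two base points suffice: left multiplication by elements of \<open>N\<close> commutes with the action, and each of
  its orbits contains the coordinate of \<open>1\<close> or of \<open>t\<close>.
\<close>

lemma (in biregular) classified_two_faces:
  assumes ord: "order M = 4 * b" and t: "letter M Gt \<notin> face_group"
    and check: "list_all (\<lambda>c. list_all (\<lambda>yw.
        \<not> admissible a b [] (half_act (int b) c yw) [((0, False), False), ((0, False), True)] ((0, False), False) \<or>
        recognised relss (half_act (int b) c yw) ((0, False), False)) (half_words b)) (codes b)"
    and relss: "\<And>rels. rels \<in> set relss \<Longrightarrow> \<exists>i<12. rels = H2_relators ! i \<and> order M = H2_orders ! i"
  shows "classified M"
proof -
  define val where "val = (\<lambda>(u, f). face u \<otimes> (if f then letter M Gt else \<one>))"
  let ?A = "face_codes \<times> (UNIV :: bool set)"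
  have val_closed: "val n \<in> carrier M" for n
    by (simp add: val_def split: prod.split)
  have no_t: "face u \<otimes> letter M Gt \<noteq> face v" if "u \<in> face_codes" "v \<in> face_codes" for u v
  proof
    assume "face u \<otimes> letter M Gt = face v"
    then have "letter M Gt = inv (face u) \<otimes> face v"
      by (simp add: inv_solve_left)
    moreover have "inv (face u) \<otimes> face v \<in> face_group"
      using that subgroup_face_group
      by (intro subgroup.m_closed subgroup.m_inv_closed) (auto simp: face_group_def)
    ultimately show False using t by simp
  qed
  have inj: "inj_on val ?A"
  proof (rule inj_onI, clarify)
    fix u v :: "int \<times> bool" and f g :: bool
    assume uv: "u \<in> face_codes" "v \<in> face_codes" and eq: "val (u, f) = val (v, g)"
    have "f = g"
      using eq no_t[OF uv] no_t[OF uv(2,1)] by (cases f; cases g) (auto simp: val_def)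
    with eq have "face u = face v" by (cases g) (simp_all add: val_def)
    with uv face_inj \<open>f = g\<close> show "u = v \<and> f = g"
      by (auto dest: inj_onD)
  qed
  have surj: "val ` ?A = carrier M"
  proof (rule card_subset_eq)
    show "card (val ` ?A) = card (carrier M)"
      using ord card_image[OF inj] by (simp add: order_def card_cartesian_product face_codes_def)
  qed (auto simp: finite_carrier val_closed)
  obtain c where c: "c \<in> face_codes" "letter M Gt \<otimes> letter M Gx = face c \<otimes> letter M Gt"
  proof -
    have "letter M Gt \<otimes> letter M Gx \<in> val ` ?A"
      by (simp add: surj)
    then obtain c f where cf: "c \<in> face_codes" "letter M Gt \<otimes> letter M Gx = val (c, f)"
      by blast
    \<comment> \<open>If tx were in the face stabiliser, then so would be t.\<close>
    have f
    proof (rule ccontr)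
      assume "\<not> f"
      with cf(2) have "letter M Gt \<otimes> letter M Gx \<otimes> letter M Gx = face c \<otimes> letter M Gx"
        by (simp add: val_def)
      then have "letter M Gt = face c \<otimes> letter M Gx"
        by (simp add: m_assoc letter_square)
      also have "\<dots> \<in> face_group"
        using subgroup.m_closed[OF subgroup_face_group _ x_in_face_group] cf(1) by (auto simp: face_group_def)
      finally show False using t by simp
    qed
    with cf that show thesis by (simp add: val_def)
  qed
  have half: "val n \<otimes> letter M g = val (half_step (int b) c g n)" if "g \<noteq> Gy" for g n
  proof -
    obtain u f where [simp]: "n = (u, f)" by (cases n)
    have "face u \<otimes> letter M Gt \<otimes> letter M Gs = face u \<otimes> letter M Gs \<otimes> letter M Gt"
      by (simp add: m_assoc st_commute)
    moreover have "face u \<otimes> letter M Gt \<otimes> letter M Gx = face u \<otimes> face c \<otimes> letter M Gt"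
      by (simp add: m_assoc c(2))
    moreover have "face u \<otimes> letter M Gt \<otimes> letter M Gt = face u"
      by (simp add: m_assoc letter_square)
    ultimately show ?thesis
      using that by (cases g) (auto simp: val_def face_mult face_mult_letter)
  qed
  have half_in: "half_step (int b) c g n \<in> ?A" if "n \<in> ?A" for g n
    using that by (cases g; cases n) auto
  have fold_in: "n \<in> ?A \<Longrightarrow> fold (half_step (int b) c) w n \<in> ?A" for w n
    by (induction w arbitrary: n) (auto simp: half_in simp del: mem_Sigma_iff)
  have half_fold: "val n \<otimes> word_val M w = val (fold (half_step (int b) c) w n)" if "Gy \<notin> set w" for w n
    using that
  proof (induction w arbitrary: n)
    case (Cons g w)
    then have "val n \<otimes> letter M g = val (half_step (int b) c g n)"
      by (intro half) auto
    with Cons show ?case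
      by (simp add: word_val_Cons val_closed flip: m_assoc)
  qed (simp add: val_closed)
  obtain yw where yw: "yw \<in> set (half_words b)" "letter M Gy = word_val M yw"
  proof -
    have "letter M Gy \<in> val ` ?A"
      by (simp add: surj)
    then obtain u f where u: "u \<in> face_codes" and y: "letter M Gy = val (u, f)"
      by blast
    have "val (u, f) = word_val M (face_word u @ (if f then [Gt] else []))"
      using u by (simp add: val_def word_val_append word_val_face_word word_val_single)
    with y u show thesis
      by (intro that[of "face_word u @ (if f then [Gt] else [])"])
        (auto simp: half_words_def set_codes intro!: image_eqI[of _ _ "(u, f)"])
  qed
  have "Gy \<notin> set yw"
    using yw(1) by (auto simp: half_words_def face_word_def split: if_splits)
  then have y: "val n \<otimes> letter M Gy = val (fold (half_step (int b) c) yw n)" for n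
    using half_fold yw(2) by simp
  let ?act = "half_act (int b) c yw"
  show ?thesis
  proof (rule classified_by_action[where A = ?A and val = val and act = ?act and relss = relss and extra = "[]"
        and ns = "[((0, False), False), ((0, False), True)]" and ?n0.0 = "((0, False), False)"])
    show "?act g n \<in> ?A" if "n \<in> ?A" for g n
      using half_in[OF that] fold_in[OF that] by (simp add: half_act_def)
    show "val n \<otimes> letter M g = val (?act g n)" for g n
      using half[of g n] y[of n] by (simp add: half_act_def)
    show "\<not> admissible a b [] ?act [((0, False), False), ((0, False), True)] ((0, False), False) \<or>
        recognised relss ?act ((0, False), False)"
      using check c(1) yw(1) by (auto simp: list_all_iff set_codes)
    show "val ((0, False), False) = \<one>"
      by (simp add: val_def face_letters)
  qed (use relss inj in \<open>auto simp: val_closed\<close>)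
qed

subsection \<open>Four faces\<close>

text \<open>
  With four faces the cosets of the face stabiliser \<open>N\<close> are represented by \<open>1, y, t, ty\<close>, and every element
  is \<open>n t\<^sup>f y\<^sup>h\<close>. Since \<open>xy = yx\<close>, \<open>st = ts\<close> and \<open>ty = yt\<close>, the only products whose coordinates are unknown are
  \<open>tx\<close> and \<open>ys\<close>; they are the parameters \<open>c\<close> and \<open>d\<close>. All other products follow by moving the letters past
  each other.
\<close>

fun four_act :: "int \<Rightarrow> (int \<times> bool) \<times> bool \<times> bool \<Rightarrow> (int \<times> bool) \<times> bool \<times> bool \<Rightarrow> gen \<Rightarrow>
    (int \<times> bool) \<times> bool \<times> bool \<Rightarrow> (int \<times> bool) \<times> bool \<times> bool" where
  "four_act m c d Gx (u, f, h) =
     (if f then case c of (v, f', h') \<Rightarrow> (dihedral_mult m u v, f', h' \<noteq> h)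
      else (dihedral_mult m u (0, True), f, h))"
| "four_act m c d Gs (u, f, h) =
     (if h then case d of (v, f', h') \<Rightarrow> (dihedral_mult m u v, f' \<noteq> f, h')
      else (dihedral_mult m u (1, True), f, h))"
| "four_act m c d Gt (u, f, h) = (u, \<not> f, h)"
| "four_act m c d Gy (u, f, h) = (u, f, \<not> h)"

definition four_word :: "(int \<times> bool) \<times> bool \<times> bool \<Rightarrow> gen list" where
  "four_word = (\<lambda>(u, f, h). face_word u @ (if f then [Gt] else []) @ (if h then [Gy] else []))"

text \<open>
  The definitions of the parameters \<open>c\<close> and \<open>d\<close>, read as relators. Some parameters define an action that
  obeys the base relators but is not regular; there a word can fix the coordinate of the unit without
  acting trivially, and these two words expose it.
\<close>

definition four_relators :: "(int \<times> bool) \<times> bool \<times> bool \<Rightarrow> (int \<times> bool) \<times> bool \<times> bool \<Rightarrow> gen list list" where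
  "four_relators c d = [[Gt, Gx] @ rev (four_word c), [Gy, Gs] @ rev (four_word d)]"

definition flags :: "(bool \<times> bool) list" where
  "flags = List.product [False, True] [False, True]"

lemma set_flags: "set flags = UNIV"
  by (auto simp: flags_def)

text \<open>
  In the dihedral group of order \<open>6\<close> an involution commutes only with itself and the unit.
\<close>

lemma (in biregular) face_code_of_commuting:
  assumes "b = 3" "u \<in> face_codes" "face u \<otimes> face u = \<one>" "face u \<noteq> \<one>"
    and "face u \<otimes> face v = face v \<otimes> face u" "v \<in> {(0, True), (1, True)}"
  shows "u = v"
proof -
  have codes_eq: "w = w'" if "face w = face w'" "w \<in> face_codes" "w' \<in> face_codes" for w w'
    using that face_inj by (auto dest: inj_onD)
  have int_b: "int b = 3"
    using assms(1) by simp
  have mult_codes: "dihedral_mult 3 w w' \<in> face_codes" for w w'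
    using dihedral_mult_codes[of w w'] by (simp only: int_b)
  have "face (dihedral_mult 3 u u) = face (0, False)" "face (dihedral_mult 3 u v) = face (dihedral_mult 3 v u)"
    using assms(3,5) face_mult[of u u] face_mult[of u v] face_mult[of v u]
    by (simp_all add: face_letters int_b)
  then have "dihedral_mult 3 u u = (0, False)" "dihedral_mult 3 u v = dihedral_mult 3 v u"
    using codes_eq mult_codes codes_letters(1) by blast+
  moreover have "u \<noteq> (0, False)"
    using assms(4) by (auto simp: face_letters)
  moreover have "u \<in> set (codes 3)"
    using assms(2) set_codes unfolding assms(1) by simp
  ultimately show ?thesis
    using assms(6) by (auto simp: codes_def upt_rec dihedral_mult_def)
qed

text \<open>
  The cosets of the face stabiliser \<open>N\<close> of \<open>y\<close>, \<open>t\<close> and \<open>ty\<close> have to be shown nontrivial. An involution \<open>y\<close> in \<open>N\<close>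
  commuting with \<open>x\<close> would equal \<open>x\<close>; likewise \<open>t\<close> with \<open>s\<close>. If \<open>ty\<close> were in \<open>N\<close>, then \<open>Ny = Nt\<close> would be fixed by
  \<open>x\<close> and \<open>s\<close>, and exchanged with \<open>N\<close> by \<open>y\<close> and \<open>t\<close>, so that \<open>N\<close> and \<open>Ny\<close> would be all cosets, although the
  index is four.
\<close>

lemma (in biregular) classified_four_faces:
  assumes a: "a = 2" and b: "b = 3" and ord: "order M = 24"
    and check: "list_all (\<lambda>c. list_all (\<lambda>d.
        \<not> admissible 2 3 (four_relators c d) (four_act 3 c d) (map (Pair (0, False)) flags) ((0, False), False, False) \<or>
        recognised relss (four_act 3 c d) ((0, False), False, False))
          (List.product (codes 3) flags)) (List.product (codes 3) flags)"
    and relss: "\<And>rels. rels \<in> set relss \<Longrightarrow> \<exists>i<12. rels = H2_relators ! i \<and> order M = H2_orders ! i"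
  shows "classified M"
proof -
  have int_b: "int b = 3"
    using b by simp
  have mult_codes: "dihedral_mult 3 w w' \<in> face_codes" for w w'
    using dihedral_mult_codes[of w w'] by (simp only: int_b)
  have codes_3: "set (codes 3) = face_codes"
    using set_codes unfolding b .
  let ?x = "letter M Gx" and ?y = "letter M Gy" and ?s = "letter M Gs" and ?t = "letter M Gt"
  have ty_square: "word_val M [Gt, Gy, Gt, Gy] = \<one>"
    using base_relators_hold[of "[Gt, Gy] \<up> 2"] a by (simp add: base_relators_def numeral_2_eq_2)
  note ty_commute = letters_commute[OF ty_square]
  have letter_inj: "letter M g = letter M h \<longleftrightarrow> g = h" for g h
    using letters_distinct by (cases g; cases h) auto
  have not_face: "letter M g \<notin> face_group" if "g = Gy \<and> h = Gx \<or> g = Gt \<and> h = Gs" for g h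
  proof
    assume "letter M g \<in> face_group"
    then obtain u where u: "u \<in> face_codes" "letter M g = face u" by (auto simp: face_group_def)
    define v :: "int \<times> bool" where "v = (if h = Gx then (0, True) else (1, True))"
    have h: "letter M h = face v" using that by (auto simp: v_def face_letters)
    have "u = v"
    proof (rule face_code_of_commuting[OF b u(1)])
      show "face u \<otimes> face u = \<one>" "face u \<noteq> \<one>"
        using letter_square[of g] letter_ne_one[of g] by (simp_all add: u(2))
      show "face u \<otimes> face v = face v \<otimes> face u"
        using that xy_commute st_commute by (auto simp flip: u(2) h)
    qed (simp add: v_def)
    then have "letter M g = letter M h" using u(2) h by simp
    with that letter_inj show False by auto
  qed
  have y: "?y \<notin> face_group" and t: "?t \<notin> face_group"
    using not_face by blast+
  have ty: "?t \<otimes> ?y \<notin> face_group"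
  proof
    assume ty: "?t \<otimes> ?y \<in> face_group"
    note mem = subgroup.m_closed[OF subgroup_face_group]
    have face_cl: "n \<in> carrier M" if "n \<in> face_group" for n
      using that by (auto simp: face_group_def)
    \<comment> \<open>The union of N and Ny is closed under right multiplication by the generators.\<close>
    define A where "A = face_group \<union> (\<lambda>n. n \<otimes> ?y) ` face_group"
    have in_A: "n \<in> face_group \<Longrightarrow> n \<in> A" "n \<in> face_group \<Longrightarrow> n \<otimes> ?y \<in> A" for n
      by (auto simp: A_def)
    have step: "n \<otimes> letter M g \<in> A" if n: "n \<in> A" for n g
    proof -
      consider (face) "n \<in> face_group" | (coset) m where "m \<in> face_group" "n = m \<otimes> ?y"
        using n by (auto simp: A_def)
      then show ?thesis
      proof cases
        case face
        have "n \<otimes> ?t = (n \<otimes> (?t \<otimes> ?y)) \<otimes> ?y"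
          using face_cl[OF face] by (simp add: m_assoc letter_square)
        then show ?thesis
          using face ty by (cases g) (auto intro!: in_A mem x_in_face_group s_in_face_group)
      next
        case coset
        have m: "m \<in> carrier M" using coset face_cl by blast
        have "n \<otimes> ?x = (m \<otimes> ?x) \<otimes> ?y"
          using m by (simp add: coset m_assoc xy_commute)
        moreover have "n \<otimes> ?y = m"
          using m by (simp add: coset m_assoc letter_square)
        moreover have "n \<otimes> ?t = m \<otimes> (?t \<otimes> ?y)"
          using m by (simp add: coset m_assoc ty_commute)
        \<comment> \<open>As y = (ty)t and t commutes with s, moving s across y leaves a factor ty on either side.\<close>
        moreover have "n \<otimes> ?s = (m \<otimes> (?t \<otimes> ?y) \<otimes> ?s \<otimes> (?t \<otimes> ?y)) \<otimes> ?y"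
        proof -
          have "?t \<otimes> (?y \<otimes> (?s \<otimes> ?t)) = ?y \<otimes> (?t \<otimes> ?t \<otimes> ?s)"
            using ty_commute by (simp add: st_commute m_assoc[symmetric]) 
          then show ?thesis
            using m by (simp add: coset m_assoc letter_square)
        qed
        moreover have "m \<in> A" "m \<otimes> (?t \<otimes> ?y) \<in> A" "(m \<otimes> ?x) \<otimes> ?y \<in> A"
            "(m \<otimes> (?t \<otimes> ?y) \<otimes> ?s \<otimes> (?t \<otimes> ?y)) \<otimes> ?y \<in> A"
          using coset(1) ty by (auto intro!: in_A mem x_in_face_group s_in_face_group)
        ultimately show ?thesis
          by (cases g) simp_all
      qed
    qed
    have "n \<in> A \<Longrightarrow> n \<otimes> word_val M w \<in> A" for n w
    proof (induction w arbitrary: n)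
      case (Cons g w)
      moreover have "n \<in> carrier M" using Cons.prems face_cl by (auto simp: A_def)
      ultimately show ?case using step by (simp add: word_val_Cons flip: m_assoc)
    qed (use face_cl in \<open>auto simp: A_def\<close>)
    from this[OF in_A(1)[OF subgroup.one_closed[OF subgroup_face_group]]] have "carrier M \<subseteq> A"
      by (auto simp: carrier_eq_words)
    then have "order M \<le> card A"
      unfolding order_def by (intro card_mono) (auto simp: A_def face_group_def face_codes_def)
    also have "\<dots> \<le> card face_group + card ((\<lambda>n. n \<otimes> ?y) ` face_group)"
      unfolding A_def by (rule card_Un_le)
    also have "\<dots> \<le> card face_group + card face_group"
      by (intro add_left_mono card_image_le) (simp add: face_group_def face_codes_def)
    finally show False
      using ord b card_face_group by simp
  qed
  define pick where "pick = (\<lambda>g f. if f then letter M g else \<one>)"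
  have pick_closed [simp]: "pick g f \<in> carrier M" for g f
    by (simp add: pick_def)
  have pick_mult: "pick g f \<otimes> pick g f' = pick g (f \<noteq> f')" for g f f'
    by (auto simp: pick_def letter_square)
  have pick_True: "pick g True = letter M g" for g
    by (simp add: pick_def)
  have pick_commute: "pick Gy h \<otimes> pick Gt f = pick Gt f \<otimes> pick Gy h"
      "pick Gt f \<otimes> ?s = ?s \<otimes> pick Gt f" "pick Gy h \<otimes> ?x = ?x \<otimes> pick Gy h" for f h
    by (auto simp: pick_def ty_commute st_commute xy_commute)
  define val where "val = (\<lambda>(u, f, h). face u \<otimes> (pick Gt f \<otimes> pick Gy h))"
  let ?A = "face_codes \<times> (UNIV :: (bool \<times> bool) set)"
  have val_closed: "val n \<in> carrier M" for n
    by (simp add: val_def split: prod.split)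
  have trivial: "\<not> f \<and> \<not> h" if "pick Gt f \<otimes> pick Gy h \<in> face_group" for f h
    using that y t ty by (auto simp: pick_def split: if_splits)
  have inj: "inj_on val ?A"
  proof (rule inj_onI)
    fix n n' assume n: "n \<in> ?A" "n' \<in> ?A" "val n = val n'"
    obtain u f h u' f' h' where [simp]: "n = (u, f, h)" "n' = (u', f', h')"
      by (cases n; cases n')
    have u: "face u \<in> face_group" "face u' \<in> face_group"
      using n by (auto simp: face_group_def)
    \<comment> \<open>Multiplying by the representative of the second coset, an involution or 1, moves it to the other side.\<close>
    have "face u \<otimes> (pick Gt f \<otimes> pick Gy h) \<otimes> (pick Gt f' \<otimes> pick Gy h')
        = face u' \<otimes> (pick Gt f' \<otimes> pick Gy h') \<otimes> (pick Gt f' \<otimes> pick Gy h')"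
      using n(3) by (simp add: val_def)
    moreover have "(pick Gt f \<otimes> pick Gy h) \<otimes> (pick Gt f' \<otimes> pick Gy h') = pick Gt (f \<noteq> f') \<otimes> pick Gy (h \<noteq> h')"
      for f h
    proof -
      have "(pick Gt f \<otimes> pick Gy h) \<otimes> (pick Gt f' \<otimes> pick Gy h')
          = pick Gt f \<otimes> (pick Gy h \<otimes> pick Gt f') \<otimes> pick Gy h'"
        by (simp add: m_assoc)
      also have "\<dots> = (pick Gt f \<otimes> pick Gt f') \<otimes> (pick Gy h \<otimes> pick Gy h')"
        by (simp add: pick_commute(1) m_assoc)
      finally show ?thesis by (simp only: pick_mult)
    qed
    ultimately have "face u \<otimes> (pick Gt (f \<noteq> f') \<otimes> pick Gy (h \<noteq> h')) = face u'"
      by (simp add: m_assoc) (simp add: pick_def)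
    then have "pick Gt (f \<noteq> f') \<otimes> pick Gy (h \<noteq> h') = inv (face u) \<otimes> face u'"
      by (simp add: inv_solve_left)
    also have "\<dots> \<in> face_group"
      using u subgroup_face_group by (intro subgroup.m_closed subgroup.m_inv_closed)
    finally have "f = f'" "h = h'"
      using trivial by blast+
    with n face_inj show "n = n'"
      by (auto simp: val_def dest: inj_onD)
  qed
  have surj: "val ` ?A = carrier M"
  proof (rule card_subset_eq)
    have "card face_codes = 6"
      unfolding face_codes_def int_b by (simp add: card_cartesian_product)
    then show "card (val ` ?A) = card (carrier M)"
      using ord card_image[OF inj]
      by (simp add: order_def card_cartesian_product flip: UNIV_Times_UNIV)
  qed (auto simp: finite_carrier val_closed)
  have "?t \<otimes> ?x \<in> val ` ?A" "?y \<otimes> ?s \<in> val ` ?A"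
    by (simp_all add: surj)
  then obtain c d where c: "c \<in> ?A" "?t \<otimes> ?x = val c" and d: "d \<in> ?A" "?y \<otimes> ?s = val d"
    by blast
  obtain cu cf ch du df dh where cd: "c = (cu, cf, ch)" "d = (du, df, dh)"
    by (cases c; cases d)
  let ?act = "four_act 3 c d"
  have act: "val n \<otimes> letter M g = val (?act g n)" for g n
  proof -
    obtain u f h where n: "n = (u, f, h)" by (cases n)
    show ?thesis
    proof (cases g)
      case Gy
      then show ?thesis
        by (simp add: n val_def m_assoc pick_mult flip: pick_True)
    next
      case Gt
      have "pick Gt f \<otimes> pick Gy h \<otimes> pick Gt True = pick Gt f \<otimes> pick Gt True \<otimes> pick Gy h"
        by (simp add: m_assoc pick_commute)
      with Gt show ?thesis
        by (simp add: n val_def m_assoc pick_mult flip: pick_True)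
    next
      case Gx
      have "val n \<otimes> ?x = face u \<otimes> (pick Gt f \<otimes> ?x) \<otimes> pick Gy h"
        by (simp add: n val_def m_assoc pick_commute)
      also have "\<dots> = val (?act Gx n)"
      proof (cases f)
        case True
        have "face u \<otimes> (pick Gt f \<otimes> ?x) \<otimes> pick Gy h
            = (face u \<otimes> face cu) \<otimes> (pick Gt cf \<otimes> (pick Gy ch \<otimes> pick Gy h))"
          using c(2) True by (simp add: pick_True cd val_def m_assoc)
        then show ?thesis
          by (simp add: n True cd val_def pick_mult face_mult int_b)
      next
        case False
        then show ?thesis
          by (simp add: n val_def pick_def face_mult_letter int_b flip: m_assoc)
      qed
      finally show ?thesis by (simp add: Gx)
    next
      case Gs
      have "pick Gt f \<otimes> pick Gy h \<otimes> ?s = (pick Gy h \<otimes> ?s) \<otimes> pick Gt f"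
        by (simp add: m_assoc pick_commute flip: pick_commute(1))
      then have "val n \<otimes> ?s = face u \<otimes> (pick Gy h \<otimes> ?s) \<otimes> pick Gt f"
        by (simp add: n val_def m_assoc)
      also have "\<dots> = val (?act Gs n)"
      proof (cases h)
        case True
        have "face u \<otimes> (pick Gy h \<otimes> ?s) \<otimes> pick Gt f
            = (face u \<otimes> face du) \<otimes> (pick Gt df \<otimes> (pick Gy dh \<otimes> pick Gt f))"
          using d(2) True by (simp add: pick_True cd val_def m_assoc)
        also have "pick Gt df \<otimes> (pick Gy dh \<otimes> pick Gt f) = pick Gt (df \<noteq> f) \<otimes> pick Gy dh"
          by (simp add: pick_commute(1) flip: m_assoc) (simp add: pick_mult)
        finally show ?thesis
          by (simp add: n True cd val_def face_mult int_b)
      next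
        case False
        then show ?thesis
          by (simp add: n val_def pick_def face_mult_letter int_b)
      qed
      finally show ?thesis by (simp add: Gs)
    qed
  qed
  show ?thesis
  proof (rule classified_by_action[where A = ?A and val = val and act = ?act and relss = relss and extra = "four_relators c d"
        and ns = "map (Pair (0, False)) flags" and ?n0.0 = "((0, False), False, False)"])
    show "?act g n \<in> ?A" if "n \<in> ?A" for g n
      using that mult_codes by (cases g; cases n) (auto simp: cd)
    show "\<not> admissible a b (four_relators c d) ?act (map (Pair (0, False)) flags) ((0, False), False, False) \<or>
        recognised relss ?act ((0, False), False, False)"
      using check c(1) d(1) by (auto simp: list_all_iff codes_3 set_flags a b)
    have "word_val M (four_word n) = val n" if "n \<in> ?A" for n
      using that by (cases n) (simp add: four_word_def val_def pick_def word_val_append word_val_face_word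
          word_val_single)
    then show "word_val M r = \<one>" if "r \<in> set (four_relators c d)" for r
      using that c d val_closed
      by (auto simp: four_relators_def word_val_append word_val_rev word_val_Cons m_assoc simp flip: m_assoc)
    show "val ((0, False), False, False) = \<one>"
      by (simp add: val_def pick_def face_letters)
  qed (use relss act inj in \<open>auto simp: val_closed\<close>)
qed

section \<open>The finite checks\<close>

text \<open>
  In each list the parameters run over all codes, whether or not they belong to a map; the inadmissible
  ones are discarded. The sublists of \<open>H2_relators\<close> hold the presentations of the order in question.
\<close>

lemma one_face_checks:
  "list_all (\<lambda>u. list_all (\<lambda>v. \<not> admissible 4 4 [] (whole_act 4 u v) [(0, False)] (0, False) \<or>
     recognised (take 1 (drop 0 H2_relators)) (whole_act 4 u v) (0, False)) (codes 4)) (codes 4)"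
  "list_all (\<lambda>u. list_all (\<lambda>v. \<not> admissible 2 6 [] (whole_act 6 u v) [(0, False)] (0, False) \<or>
     recognised (take 1 (drop 1 H2_relators)) (whole_act 6 u v) (0, False)) (codes 6)) (codes 6)"
  by code_simp+

lemma two_faces_checks:
  "list_all (\<lambda>c. list_all (\<lambda>yw.
     \<not> admissible 3 3 [] (half_act 3 c yw) [((0, False), False), ((0, False), True)] ((0, False), False) \<or>
     recognised (take 1 (drop 2 H2_relators)) (half_act 3 c yw) ((0, False), False)) (half_words 3)) (codes 3)"
  "list_all (\<lambda>c. list_all (\<lambda>yw.
     \<not> admissible 2 4 [] (half_act 4 c yw) [((0, False), False), ((0, False), True)] ((0, False), False) \<or>
     recognised (take 6 (drop 3 H2_relators)) (half_act 4 c yw) ((0, False), False)) (half_words 4)) (codes 4)"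
  by code_simp+

lemma four_faces_check:
  "list_all (\<lambda>c. list_all (\<lambda>d.
     \<not> admissible 2 3 (four_relators c d) (four_act 3 c d) (map (Pair (0, False)) flags) ((0, False), False, False) \<or>
     recognised (take 3 (drop 9 H2_relators)) (four_act 3 c d) ((0, False), False, False))
       (List.product (codes 3) flags)) (List.product (codes 3) flags)"
  by code_simp

section \<open>The classification\<close>

text \<open>
  With \<open>m\<close> faces, \<open>n = 2 b m\<close>, and the Euler characteristic gives \<open>m (ab - a - b) = 2a\<close>. Hence
  \<open>b (a - 1) \<le> 3a\<close>, which with \<open>a \<le> b\<close> leaves finitely many pairs.
\<close>

lemma euler_type_arith:
  fixes a b n :: nat
  assumes "2 \<le> a" "a \<le> b" "0 < n" "2 * b dvd n"
    and euler: "real n / real (2 * a) - real n / 2 + real n / real (2 * b) = -2"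
  shows "(a, b, n) \<in> {(4, 4, 8), (2, 6, 12), (3, 3, 12), (2, 4, 16), (2, 3, 24)}"
proof -
  obtain m where n: "n = 2 * b * m"
    using \<open>2 * b dvd n\<close> by blast
  have "m \<noteq> 0" using \<open>0 < n\<close> n by (auto intro: ccontr)
  have "real n * (real a * real b - real a - real b) = 4 * real a * real b"
    using euler assms(1,2) by (simp add: field_simps)
  then have "(2 * real b) * (real m * (real a * real b - real a - real b)) = (2 * real b) * (2 * real a)"
    by (simp add: n algebra_simps)
  then have "real m * (real a * real b - real a - real b) = 2 * real a"
    by (rule mult_left_cancel[THEN iffD1, rotated]) (use assms(1,2) in simp)
  then have "real_of_int (int m * (int a * int b - int a - int b)) = real_of_int (2 * int a)"
    by simp
  then have eq: "int m * (int a * int b - int a - int b) = 2 * int a"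
    by (simp only: of_int_eq_iff)
  then have "int a * int b - int a - int b \<le> 2 * int a"
    using \<open>m \<noteq> 0\<close> \<open>2 \<le> a\<close> by (metis dvd_triv_right zdvd_imp_le of_nat_0_less_iff zero_less_mult_iff zero_less_numeral
        less_le_trans pos2)
  then have le: "int b * (int a - 1) \<le> 3 * int a"
    by (simp add: algebra_simps)
  have "int a * (int a - 1) \<le> int b * (int a - 1)"
    using assms(1,2) by (intro mult_right_mono) auto
  with le have "int a * (int a - 1) \<le> int a * 3"
    by linarith
  then have "a \<le> 4"
    using assms(1) by (simp add: mult_le_cancel_left)
  with \<open>2 \<le> a\<close> consider "a = 2" | "a = 3" | "a = 4" by linarith
  then show ?thesis
  proof cases
    case 1
    with le have "b \<in> {2, 3, 4, 5, 6}" using assms(2) by auto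
    with 1 eq n show ?thesis by auto presburger+
  next
    case 2
    with le have "b \<in> {3, 4}" using assms(2) by auto
    with 2 eq n show ?thesis by auto presburger+
  next
    case 3
    with le have "b = 4" using assms(2) by auto
    with 3 eq n show ?thesis by auto
  qed
qed

lemma H2_relators_sublistD:
  assumes "k + m \<le> 12" "list_all (\<lambda>i. H2_orders ! i = n) [k..<k + m]"
    and "rels \<in> set (take m (drop k H2_relators))"
  shows "\<exists>i<12. rels = H2_relators ! i \<and> n = H2_orders ! i"
proof -
  obtain j where "j < m" "rels = H2_relators ! (k + j)"
    using assms(1,3) by (auto simp: in_set_conv_nth H2_lengths)
  with assms(1,2) show ?thesis
    by (intro exI[of _ "k + j"]) (auto simp: list_all_iff)
qed

text \<open>
  If \<open>t\<close> belongs to the face stabiliser, then \<open>y\<close> does not, since otherwise the stabiliser would be the whole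
  group. Twinning preserves the face stabiliser and exchanges \<open>y\<close> with \<open>t\<close>.
\<close>

lemma (in biregular) classified_two_faces_or_twin:
  assumes ord: "order M = 4 * b"
    and check: "list_all (\<lambda>c. list_all (\<lambda>yw.
        \<not> admissible a b [] (half_act (int b) c yw) [((0, False), False), ((0, False), True)] ((0, False), False) \<or>
        recognised relss (half_act (int b) c yw) ((0, False), False)) (half_words b)) (codes b)"
    and relss: "\<And>rels. rels \<in> set relss \<Longrightarrow> \<exists>i<12. rels = H2_relators ! i \<and> order M = H2_orders ! i"
  shows "classified M"
proof (cases "letter M Gt \<in> face_group")
  case False
  then show ?thesis by (rule classified_two_faces[OF ord _ check relss])
next
  case t: True
  let ?T = "relabel twin_gen M"
  interpret T: biregular ?T a b by (rule biregular_twin)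
  have "letter M Gy \<notin> face_group"
  proof
    assume "letter M Gy \<in> face_group"
    with t have "letter M g \<in> face_group" for g
      by (cases g) (simp_all add: x_in_face_group s_in_face_group)
    then have "word_val M w \<in> face_group" for w
      by (induction w)
        (auto simp: word_val_Cons intro: subgroup.m_closed[OF subgroup_face_group]
          subgroup.one_closed[OF subgroup_face_group])
    then have "carrier M \<subseteq> face_group"
      by (auto simp: carrier_eq_words)
    then have "card (carrier M) \<le> card face_group"
      by (intro card_mono) (simp_all add: face_group_def face_codes_def)
    then show False
      using ord card_face_group b_ge_2 by (simp add: order_def)
  qed
  moreover have "T.face_group \<subseteq> face_group"
  proof -
    have "m_inv ?T z = inv z" for z
      by (simp add: m_inv_def)
    then have "subgroup face_group ?T"
      using subgroup_face_group by (simp add: subgroup_def)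
    then show ?thesis
      unfolding T.face_group_eq_generate
      by (intro T.generate_subgroup_incl) (simp_all add: x_in_face_group s_in_face_group)
  qed
  ultimately have "letter ?T Gt \<notin> T.face_group"
    by auto
  then have "classified ?T"
    using T.classified_two_faces check relss ord by simp
  then show ?thesis
    by (rule classified_relabel[rotated]) (simp add: relabellings_def)
qed

lemma (in biregular) classified_if_a_le_b:
  assumes "a \<le> b"
    and euler: "real (order M) / real (2 * a) - real (order M) / 2 + real (order M) / real (2 * b) = -2"
  shows "classified M"
proof -
  have "0 < order M"
    using finite_carrier by (simp add: order_gt_0_iff_finite)
  then consider "a = 4" "b = 4" "order M = 8" | "a = 2" "b = 6" "order M = 12"
    | "a = 3" "b = 3" "order M = 12" | "a = 2" "b = 4" "order M = 16" | "a = 2" "b = 3" "order M = 24"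
    using euler_type_arith[OF a_ge_2 \<open>a \<le> b\<close> _ order_dvd euler] by blast
  then show ?thesis
  proof cases
    case 1
    show ?thesis
      by (rule classified_one_face[where relss = "take 1 (drop 0 H2_relators)",
            OF _ _ H2_relators_sublistD[of 0 1]])
        (use 1 one_face_checks(1) in \<open>simp_all add: H2_orders_def upt_rec\<close>)
  next
    case 2
    show ?thesis
      by (rule classified_one_face[where relss = "take 1 (drop 1 H2_relators)",
            OF _ _ H2_relators_sublistD[of 1 1]])
        (use 2 one_face_checks(2) in \<open>simp_all add: H2_orders_def upt_rec\<close>)
  next
    case 3
    show ?thesis
      by (rule classified_two_faces_or_twin[where relss = "take 1 (drop 2 H2_relators)",
            OF _ _ H2_relators_sublistD[of 2 1]])
        (use 3 two_faces_checks(1) in \<open>simp_all add: H2_orders_def upt_rec\<close>)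
  next
    case 4
    show ?thesis
      by (rule classified_two_faces_or_twin[where relss = "take 6 (drop 3 H2_relators)",
            OF _ _ H2_relators_sublistD[of 3 6]])
        (use 4 two_faces_checks(2) in \<open>simp_all add: H2_orders_def upt_rec\<close>)
  next
    case 5
    show ?thesis
      by (rule classified_four_faces[where relss = "take 3 (drop 9 H2_relators)",
            OF _ _ _ _ H2_relators_sublistD[of 9 3]])
        (use 5 four_faces_check in \<open>simp_all add: H2_orders_def upt_rec\<close>)
  qed
qed

lemma (in biregular) classified_if_euler:
  assumes "real (order M) / real (2 * a) - real (order M) / 2 + real (order M) / real (2 * b) = -2"
  shows "classified M"
proof (cases "a \<le> b")
  case True
  then show ?thesis using assms by (rule classified_if_a_le_b)
next
  case False
  interpret D: biregular "relabel dual_gen M" b a by (rule biregular_dual)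
  have "classified (relabel dual_gen M)"
    using False assms by (intro D.classified_if_a_le_b) simp_all
  then show ?thesis
    by (rule classified_relabel[rotated]) (simp add: relabellings_def)
qed

lemma classified_iso:
  assumes M: "marked_group M" and "classified M"
  shows "\<exists>i\<in>{1..12}. iso_up_to_dual_twin M (H2 i)"
proof -
  obtain i \<sigma> where i: "i < 12" and \<sigma>: "\<sigma> \<in> set relabellings" and ord: "order M = H2_orders ! i"
    and sat: "satisfies (relabel \<sigma> M) (H2_relators ! i)"
    using \<open>classified M\<close> by (auto simp: classified_def)
  interpret certified_cayley_table "H2_relators ! i" "H2_orders ! i" "cayley_tables ! i"
    using H2_table[of "Suc i"] i by simp
  interpret N: marked_group "relabel \<sigma> M"
    by (rule marked_group_relabel[OF M \<sigma>])
  have "map_iso P (relabel \<sigma> M)"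
    using map_iso_presented_map[OF N.marked_group_axioms sat squares_subset finite_P] ord order_P by simp
  then have "map_iso (relabel \<sigma> M) P"
    by (rule map_iso_sym[OF P.is_group N.is_group P.letter_closed])
  then have "map_iso (relabel \<sigma> (relabel \<sigma> M)) (relabel \<sigma> P)"
    by (rule map_iso_relabel)
  then have "map_iso M (relabel \<sigma> P)"
    using relabelling_involution[OF \<sigma>] by (simp add: relabel_relabel)
  then have "iso_up_to_dual_twin M (H2 (Suc i))"
    using \<sigma> by (auto simp: iso_up_to_dual_twin_def dual_twin_orbit_eq H2_def)
  with i show ?thesis by (intro bexI[of _ "Suc i"]) auto
qed

lemma edge_biregular_map_classification:
  assumes "edge_biregular_map M k l" "euler_char M k l = -2"
  shows "\<exists>i\<in>{1..12}. iso_up_to_dual_twin M (H2 i)"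
proof -
  interpret biregular M "k div 2" "l div 2"
    by (rule edge_biregular_map_biregular) fact
  have "even k" "even l"
    using assms(1) edge_biregular_map.even_k edge_biregular_map.even_l by blast+
  then have "classified M"
    using assms(2) by (intro classified_if_euler)
      (simp add: euler_char_def num_vertices_def num_edges_def num_faces_def)
  then show ?thesis
    by (rule classified_iso[OF marked_group_axioms])
qed

section \<open>The twelve maps\<close>

theorem theorem3p2:
  shows
    "(\<forall>(M :: 'a ebmap) k l. edge_biregular_map M k l \<and> euler_char M k l = -2 \<longrightarrow>
        (\<exists>i\<in>{1..12}. iso_up_to_dual_twin M (H2 i))) \<and>
     (\<forall>i\<in>{1..12}. \<forall>j\<in>{1..12}. i \<noteq> j \<longrightarrow> \<not> iso_up_to_dual_twin (H2 i) (H2 j)) \<and>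
     (edge_biregular_map (H2 1) 8 8 \<and> euler_char (H2 1) 8 8 = -2 \<and>
        num_vertices (H2 1) 8 = 1 \<and> num_faces (H2 1) 8 = 1 \<and>
        self_dual (H2 1) \<and> H2 1 \<cong> dihedral_group 8) \<and>
     (edge_biregular_map (H2 2) 4 12 \<and> euler_char (H2 2) 4 12 = -2 \<and>
        num_vertices (H2 2) 4 = 3 \<and> num_faces (H2 2) 12 = 1 \<and>
        H2 2 \<cong> dihedral_group 12) \<and>
     (edge_biregular_map (H2 3) 6 6 \<and> euler_char (H2 3) 6 6 = -2 \<and>
        num_vertices (H2 3) 6 = 2 \<and> num_faces (H2 3) 6 = 2 \<and>
        self_dual (H2 3) \<and> H2 3 \<cong> dihedral_group 12) \<and>
     (\<forall>i\<in>{4..9}. edge_biregular_map (H2 i) 4 8 \<and> euler_char (H2 i) 4 8 = -2 \<and>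
        num_vertices (H2 i) 4 = 4 \<and> num_faces (H2 i) 8 = 2 \<and>
        H2 i \<cong> dihedral_group 8 \<times>\<times> cyclic2) \<and>
     (\<forall>i\<in>{10..12}. edge_biregular_map (H2 i) 4 6 \<and> euler_char (H2 i) 4 6 = -2 \<and>
        num_vertices (H2 i) 4 = 6 \<and> num_faces (H2 i) 6 = 4) \<and>
     H2 10 \<cong> sym_group 4 \<and>
     H2 11 \<cong> dihedral_group 6 \<times>\<times> klein_four \<and>
     H2 12 \<cong> dihedral_group 6 \<times>\<times> klein_four \<and>
     (\<forall>i\<in>{1..12}. orientable (H2 i) \<longleftrightarrow> i \<in> {1, 3, 4, 7, 11, 12}) \<and>
     (\<forall>i\<in>{1..12}. fully_regular (H2 i) \<longleftrightarrow> i \<in> {1, 3, 7, 10, 12})"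
proof -
  have shape: "edge_biregular_map (H2 i) (2 * a) (2 * b) \<and> order (H2 i) = n"
    if "i \<in> {1..12}" "H2_types ! (i - 1) = (a, b)" "H2_orders ! (i - 1) = n" for i a b n
    using edge_biregular_map_H2[OF that(1)] order_H2[OF that(1)] that(2,3) by simp
  have order_16: "edge_biregular_map (H2 i) 4 8 \<and> order (H2 i) = 16" if "i \<in> {4..9}" for i
  proof -
    have "i \<in> {4, 5, 6, 7, 8, 9}" using that by auto
    then show ?thesis
      using shape[of i 2 4 16] by (auto simp: H2_types_def H2_orders_def)
  qed
  have order_24: "edge_biregular_map (H2 i) 4 6 \<and> order (H2 i) = 24" if "i \<in> {10..12}" for i
  proof -
    have "i \<in> {10, 11, 12}" using that by auto
    then show ?thesis
      using shape[of i 2 3 24] by (auto simp: H2_types_def H2_orders_def)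
  qed
  have "edge_biregular_map (H2 1) 8 8 \<and> order (H2 1) = 8"
    "edge_biregular_map (H2 2) 4 12 \<and> order (H2 2) = 12"
    "edge_biregular_map (H2 3) 6 6 \<and> order (H2 3) = 12"
    using shape[of 1 4 4 8] shape[of 2 2 6 12] shape[of 3 3 3 12]
    by (simp_all add: H2_types_def H2_orders_def)
  then show ?thesis
    using order_16 order_24 edge_biregular_map_classification H2_pairwise_distinct
      self_dual_H2[of 1] self_dual_H2[of 3] orientable_H2 fully_regular_H2
      H2_1_is_iso H2_2_3_is_iso[of 2] H2_2_3_is_iso[of 3] H2_4_to_9_is_iso
      H2_10_is_iso H2_11_12_is_iso[of 11] H2_11_12_is_iso[of 12]
    by (auto simp: euler_char_def num_vertices_def num_edges_def num_faces_def)
qed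

end
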